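(* The $n$-sphere $S^n$ has a $7$-cubature formula with $O(n^4)$ points for all $n$, more precisely with $4n^4(1+o(1))$ points as $n\to\infty$. For every integer $s\ge 0$, the $3$-sphere $S^3$ has a $(2s+1)$-cubature formula $F$ with $$|F|=\begin{cases}(s+1)(s^2+3) & s\text{ odd},\\ (s+1)(s^2+s+2) & s\text{ even}\end{cases}$$ points.
   Context: $S^n\subset\mathbb{R}^{n+1}$ is the unit sphere with normalized uniform measure $\mu$. A $d$-cubature formula on $S^n$ is a finite set $F=\{p_a\}\subset S^n$ with real weights $w_a$ such that $\int_{S^n}P\,d\mu=\sum_a w_aP(p_a)$ for all polynomials $P$ on $\mathbb{R}^{n+1}$ of degree at most $d$; $|F|$ is the number of points. *)

theory Defs
  imports "HOL-Library.Landau_Symbols" "HOL-Probability.Probability"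
begin

text \<open>
  The dimension \<open>n\<close> is quantified inside the statement, so \<open>\<real>\<^bsup>n+1\<^esup>\<close> is the set of extensional
  functions on the index set \<open>{..n}\<close>, that is, the space of \<open>\<Pi>\<^sub>M i\<in>{..n}. lborel\<close>.
\<close>

definition eucl_norm :: "nat \<Rightarrow> (nat \<Rightarrow> real) \<Rightarrow> real" where
  "eucl_norm n x = sqrt (\<Sum>i\<le>n. (x i)\<^sup>2)"

definition unit_sphere :: "nat \<Rightarrow> (nat \<Rightarrow> real) set" where
  "unit_sphere n = {x \<in> {..n} \<rightarrow>\<^sub>E UNIV. eucl_norm n x = 1}"

definition punctured_ball :: "nat \<Rightarrow> (nat \<Rightarrow> real) set" where
  "punctured_ball n = {x \<in> {..n} \<rightarrow>\<^sub>E UNIV. 0 < eucl_norm n x \<and> eucl_norm n x \<le> 1}"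

definition radial_proj :: "nat \<Rightarrow> (nat \<Rightarrow> real) \<Rightarrow> (nat \<Rightarrow> real)" where
  "radial_proj n x = (\<lambda>i\<in>{..n}. x i / eucl_norm n x)"

text \<open>
  The normalized uniform measure of a set \<open>A\<close> on the sphere is the proportion of the volume of the
  unit ball that is occupied by the cone over \<open>A\<close>. The origin is removed because the radial
  projection is not defined there.
\<close>

definition sphere_measure :: "nat \<Rightarrow> (nat \<Rightarrow> real) measure" where
  "sphere_measure n =
     distr (uniform_measure
              (restrict_space (\<Pi>\<^sub>M i\<in>{..n}. lborel) (punctured_ball n)) (punctured_ball n))
           (restrict_space (\<Pi>\<^sub>M i\<in>{..n}. borel) (unit_sphere n))
           (radial_proj n)"

definition multi_indices :: "nat \<Rightarrow> nat \<Rightarrow> (nat \<Rightarrow> nat) set" where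
  "multi_indices n d = {\<alpha>. (\<forall>i>n. \<alpha> i = 0) \<and> (\<Sum>i\<le>n. \<alpha> i) \<le> d}"

definition poly_deg_le :: "nat \<Rightarrow> nat \<Rightarrow> ((nat \<Rightarrow> real) \<Rightarrow> real) \<Rightarrow> bool" where
  "poly_deg_le n d P \<longleftrightarrow>
     (\<exists>c :: (nat \<Rightarrow> nat) \<Rightarrow> real. \<forall>x. P x = (\<Sum>\<alpha>\<in>multi_indices n d. c \<alpha> * (\<Prod>i\<le>n. x i ^ \<alpha> i)))"

definition is_cubature ::
    "nat \<Rightarrow> nat \<Rightarrow> (nat \<Rightarrow> real) set \<Rightarrow> ((nat \<Rightarrow> real) \<Rightarrow> real) \<Rightarrow> bool" where
  "is_cubature n d F w \<longleftrightarrow>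
     finite F \<and> F \<subseteq> unit_sphere n \<and>
     (\<forall>P. poly_deg_le n d P \<longrightarrow> (\<integral>x. P x \<partial>sphere_measure n) = (\<Sum>p\<in>F. w p * P p))"

lemma finite_multi_indices: "finite (multi_indices n d)"
proof -
  have "multi_indices n d \<subseteq> {f. \<forall>i. (i \<in> {..n} \<longrightarrow> f i \<in> {..d}) \<and> (i \<notin> {..n} \<longrightarrow> f i = 0)}"
  proof (clarsimp simp: multi_indices_def)
    fix \<alpha> :: "nat \<Rightarrow> nat" and i
    assume "sum \<alpha> {..n} \<le> d" "i \<le> n"
    then show "\<alpha> i \<le> d"
      using member_le_sum[of i "{..n}" \<alpha>] by auto
  qed
  moreover have "finite \<dots>"
    by (rule finite_set_of_finite_funs) auto
  ultimately show ?thesis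
    by (rule finite_subset)
qed

lemma eucl_norm_measurable [measurable]:
  "eucl_norm n \<in> borel_measurable (\<Pi>\<^sub>M i\<in>{..n}. lborel)"
  unfolding eucl_norm_def by measurable

lemma punctured_ball_sets: "punctured_ball n \<in> sets (\<Pi>\<^sub>M i\<in>{..n}. lborel)"
proof -
  have "punctured_ball n = {x \<in> space (\<Pi>\<^sub>M i\<in>{..n}. lborel). 0 < eucl_norm n x \<and> eucl_norm n x \<le> 1}"
    by (auto simp: punctured_ball_def space_PiM)
  also have "\<dots> \<in> sets (\<Pi>\<^sub>M i\<in>{..n}. lborel)"
    by measurable
  finally show ?thesis .
qed

lemma emeasure_box:
  assumes "a \<le> (b::real)"
  shows "emeasure (\<Pi>\<^sub>M i\<in>{..n}. lborel) ({..n} \<rightarrow>\<^sub>E {a..b}) = ennreal ((b - a) ^ Suc n)"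
proof -
  interpret finite_product_sigma_finite "\<lambda>_. lborel :: real measure" "{..n}"
    by standard auto
  show ?thesis
    using assms by (subst measure_times) (auto simp: ennreal_power ennreal_mult')
qed

lemma emeasure_punctured_ball_finite:
  "emeasure (\<Pi>\<^sub>M i\<in>{..n}. lborel) (punctured_ball n) \<noteq> \<infinity>"
proof -
  have "punctured_ball n \<subseteq> {..n} \<rightarrow>\<^sub>E {-1..1::real}"
  proof
    fix x assume x: "x \<in> punctured_ball n"
    have "x i \<in> {-1..1::real}" if "i \<le> n" for i
    proof -
      have "(x i)\<^sup>2 \<le> (\<Sum>i\<le>n. (x i)\<^sup>2)"
        using that by (intro member_le_sum) auto
      also have "\<dots> \<le> 1"
        using x by (auto simp: punctured_ball_def eucl_norm_def)
      finally show ?thesis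
        by (auto simp: abs_square_le_1 abs_le_iff)
    qed
    with x show "x \<in> {..n} \<rightarrow>\<^sub>E {-1..1::real}"
      by (auto simp: punctured_ball_def PiE_iff)
  qed
  then have "emeasure (\<Pi>\<^sub>M i\<in>{..n}. lborel) (punctured_ball n)
      \<le> emeasure (\<Pi>\<^sub>M i\<in>{..n}. lborel) ({..n} \<rightarrow>\<^sub>E {-1..1::real})"
    by (rule emeasure_mono) (rule sets_PiM_I_finite, auto)
  also have "\<dots> < \<infinity>"
    by (simp add: emeasure_box)
  finally show ?thesis by simp
qed

lemma emeasure_punctured_ball_nonzero:
  "emeasure (\<Pi>\<^sub>M i\<in>{..n}. lborel) (punctured_ball n) \<noteq> 0"
proof -
  define a :: real where "a = 1 / (2 * real (Suc n))"
  define b :: real where "b = 1 / real (Suc n)"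
  have ab: "0 < a" "a < b" "b \<le> 1"
    by (auto simp: a_def b_def field_simps)
  have "{..n} \<rightarrow>\<^sub>E {a..b} \<subseteq> punctured_ball n"
  proof
    fix x assume x: "x \<in> {..n} \<rightarrow>\<^sub>E {a..b}"
    have xi: "a \<le> x i" "x i \<le> b" if "i \<le> n" for i
      using x that by (auto simp: PiE_iff)
    have "0 < (\<Sum>i\<le>n. (x i)\<^sup>2)"
      using xi ab(1) by (intro sum_pos) (auto, fastforce)
    moreover have "(\<Sum>i\<le>n. (x i)\<^sup>2) \<le> (\<Sum>i\<le>n. b)"
    proof (rule sum_mono)
      fix i assume "i \<in> {..n}"
      then have "0 \<le> x i" "x i \<le> b" using xi[of i] ab by auto
      then have "x i * x i \<le> b * 1" using ab by (intro mult_mono) auto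
      then show "(x i)\<^sup>2 \<le> b" by (simp add: power2_eq_square)
    qed
    moreover have "(\<Sum>i\<le>n. b) = 1"
      by (simp add: b_def)
    ultimately show "x \<in> punctured_ball n"
      using x by (auto simp: punctured_ball_def eucl_norm_def PiE_iff)
  qed
  then have "emeasure (\<Pi>\<^sub>M i\<in>{..n}. lborel) ({..n} \<rightarrow>\<^sub>E {a..b})
      \<le> emeasure (\<Pi>\<^sub>M i\<in>{..n}. lborel) (punctured_ball n)"
    by (intro emeasure_mono punctured_ball_sets)
  moreover have "0 < emeasure (\<Pi>\<^sub>M i\<in>{..n}. lborel) ({..n} \<rightarrow>\<^sub>E {a..b})"
    using ab by (simp add: emeasure_box)
  ultimately show ?thesis
    by (metis leD)
qed

lemma radial_proj_in_unit_sphere: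
  assumes "x \<in> punctured_ball n"
  shows "radial_proj n x \<in> unit_sphere n"
proof -
  have pos: "0 < eucl_norm n x"
    using assms by (simp add: punctured_ball_def)
  have "eucl_norm n (radial_proj n x) = sqrt ((\<Sum>i\<le>n. (x i)\<^sup>2) / (eucl_norm n x)\<^sup>2)"
    unfolding eucl_norm_def[of n "radial_proj n x"] sum_divide_distrib
    by (simp add: radial_proj_def power_divide)
  also have "(eucl_norm n x)\<^sup>2 = (\<Sum>i\<le>n. (x i)\<^sup>2)"
    by (simp add: eucl_norm_def sum_nonneg)
  finally show ?thesis
    using pos by (auto simp: unit_sphere_def radial_proj_def eucl_norm_def)
qed

lemma radial_proj_measurable:
  "radial_proj n \<in> restrict_space (\<Pi>\<^sub>M i\<in>{..n}. lborel) (punctured_ball n)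
     \<rightarrow>\<^sub>M restrict_space (\<Pi>\<^sub>M i\<in>{..n}. borel) (unit_sphere n)"
proof (rule measurable_restrict_space3)
  show "radial_proj n \<in> (\<Pi>\<^sub>M i\<in>{..n}. lborel) \<rightarrow>\<^sub>M (\<Pi>\<^sub>M i\<in>{..n}. borel)"
    unfolding radial_proj_def by measurable
  show "radial_proj n \<in> punctured_ball n \<rightarrow> unit_sphere n"
    using radial_proj_in_unit_sphere by auto
qed

lemma space_sphere_measure: "space (sphere_measure n) = unit_sphere n"
  by (auto simp: sphere_measure_def space_restrict_space space_PiM unit_sphere_def)

lemma prob_space_sphere_measure: "prob_space (sphere_measure n)"
proof -
  let ?M = "restrict_space (\<Pi>\<^sub>M i\<in>{..n}. lborel) (punctured_ball n)"
  have "emeasure ?M (punctured_ball n) = emeasure (\<Pi>\<^sub>M i\<in>{..n}. lborel) (punctured_ball n)"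
    by (rule emeasure_restrict_space)
       (use punctured_ball_sets sets.Int_space_eq2 in \<open>auto simp: punctured_ball_sets\<close>)
  then have "prob_space (uniform_measure ?M (punctured_ball n))"
    using emeasure_punctured_ball_finite emeasure_punctured_ball_nonzero
    by (intro prob_space_uniform_measure) auto
  then show ?thesis
    unfolding sphere_measure_def
    by (rule prob_space.prob_space_distr) (use radial_proj_measurable in simp)
qed

lemma poly_deg_le_integrable:
  assumes "poly_deg_le n d P"
  shows "integrable (sphere_measure n) P"
proof -
  interpret prob_space "sphere_measure n"
    by (rule prob_space_sphere_measure)
  obtain c where P: "P = (\<lambda>x. \<Sum>\<alpha>\<in>multi_indices n d. c \<alpha> * (\<Prod>i\<le>n. x i ^ \<alpha> i))"
    using assms by (auto simp: poly_deg_le_def fun_eq_iff)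
  have "P \<in> borel_measurable (\<Pi>\<^sub>M i\<in>{..n}. borel)"
    unfolding P by measurable
  then have meas: "P \<in> borel_measurable (sphere_measure n)"
    by (simp add: sphere_measure_def measurable_restrict_space1)
  have "\<bar>P x\<bar> \<le> (\<Sum>\<alpha>\<in>multi_indices n d. \<bar>c \<alpha>\<bar>)" if x: "x \<in> unit_sphere n" for x
  proof -
    have xi: "\<bar>x i\<bar> \<le> 1" if "i \<le> n" for i
    proof -
      have "(x i)\<^sup>2 \<le> (\<Sum>i\<le>n. (x i)\<^sup>2)"
        using that by (intro member_le_sum) auto
      also have "\<dots> = 1"
        using x by (simp add: unit_sphere_def eucl_norm_def)
      finally show ?thesis
        by (simp add: abs_square_le_1)
    qed
    have "\<bar>P x\<bar> \<le> (\<Sum>\<alpha>\<in>multi_indices n d. \<bar>c \<alpha> * (\<Prod>i\<le>n. x i ^ \<alpha> i)\<bar>)"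
      unfolding P by (rule sum_abs)
    also have "\<dots> \<le> (\<Sum>\<alpha>\<in>multi_indices n d. \<bar>c \<alpha>\<bar>)"
    proof (rule sum_mono)
      fix \<alpha>
      have "(\<Prod>i\<le>n. \<bar>x i\<bar> ^ \<alpha> i) \<le> 1"
        using xi by (intro prod_le_1) (auto intro: power_le_one)
      then have "\<bar>c \<alpha>\<bar> * (\<Prod>i\<le>n. \<bar>x i\<bar> ^ \<alpha> i) \<le> \<bar>c \<alpha>\<bar> * 1"
        by (rule mult_left_mono) simp
      then show "\<bar>c \<alpha> * (\<Prod>i\<le>n. x i ^ \<alpha> i)\<bar> \<le> \<bar>c \<alpha>\<bar>"
        by (simp add: abs_mult abs_prod power_abs)
    qed
    finally show ?thesis .
  qed
  then show ?thesis
    using meas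
    by (intro integrable_const_bound[where B = "\<Sum>\<alpha>\<in>multi_indices n d. \<bar>c \<alpha>\<bar>"] AE_I2)
       (auto simp: space_sphere_measure)
qed

end

theory Submission
  imports
    Defs
    "HOL-Computational_Algebra.Polynomial"
    "HOL-Library.Real_Mod"
    "HOL-Real_Asymp.Real_Asymp"
begin

text \<open>
  Both formulas come from averaging over a finite group of isometries. Plane rotations preserve
  Lebesgue measure because they are products of shears, so the spherical integral is invariant under
  them, and under sign changes and transpositions of coordinates. No moment is ever computed. Weights
  may vanish, so it is enough to construct formulas with at most the stated number of points.

  Degree 7 on \<open>S\<^sup>n\<close>: the points are \<open>(\<Sum>i\<in>U. \<plusminus>e\<^sub>i) / sqrt |U|\<close> with \<open>1 \<le> |U| \<le> 3\<close>. Monomials with an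
  odd exponent vanish on both sides, and since \<open>\<Sum>i. (x i)\<^sup>2 = 1\<close> the others reduce to
  \<open>(x i)\<^sup>2 (x j)\<^sup>2 (x k)\<^sup>2\<close>. Its integral depends only on the set \<open>{i, j, k}\<close>, and its value at a point
  belonging to \<open>U\<close> is nonzero exactly if \<open>{i, j, k} \<subseteq> U\<close>, so the weights solve a triangular system.

  Degree \<open>2s + 1\<close> on \<open>S\<^sup>3 \<subseteq> \<complex>\<^sup>2\<close>: with \<open>r = s + 1\<close>, the pairs of \<open>2r\<close>-th roots of unity whose exponents
  have equal parity form a group of order \<open>2r\<^sup>2\<close>, and averaging over it turns every polynomial of
  degree less than \<open>2r\<close> into a polynomial of degree at most \<open>s\<close> in \<open>t = |z\<^sub>1|\<^sup>2\<close>. The latter is integrated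
  by a Gauss-Radau rule (\<open>s\<close> even) or a Gauss-Lobatto rule (\<open>s\<close> odd) on \<open>[0, 1]\<close>; at the endpoints
  \<open>t = 0\<close> and \<open>t = 1\<close> the orbit has only \<open>2r\<close> points.
\<close>

section \<open>Symmetries of the spherical integral\<close>

abbreviation lborel_PiM :: "nat \<Rightarrow> (nat \<Rightarrow> real) measure" where
  "lborel_PiM n \<equiv> \<Pi>\<^sub>M i\<in>{..n}. lborel"

text \<open>Tonelli with coordinate \<open>i\<close> innermost. The outer variable lives on the
  remaining indices, hence the update \<open>x(i := y)\<close>.\<close>

lemma nn_integral_PiM_section:
  fixes f :: "(nat \<Rightarrow> real) \<Rightarrow> ennreal"
  assumes "i \<le> n" and "f \<in> borel_measurable (lborel_PiM n)"
  shows "(\<integral>\<^sup>+x. f x \<partial>lborel_PiM n) =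
    (\<integral>\<^sup>+x. (\<integral>\<^sup>+y. f (x(i := y)) \<partial>lborel) \<partial>(\<Pi>\<^sub>M i\<in>{..n} - {i}. lborel))"
proof -
  interpret product_sigma_finite "\<lambda>_::nat. lborel :: real measure"
    by standard
  have *: "{..n} = insert i ({..n} - {i})"
    using assms(1) by auto
  show ?thesis
    using product_nn_integral_insert[of "{..n} - {i}" i f] assms(2) *[symmetric]
    by simp
qed

text \<open>By \<open>hi\<close>, the shift \<open>h x\<close> is constant along every line parallel
  to the \<open>i\<close>-th axis, so on such a line \<open>T\<close> is a translation, possibly
  combined with a reflection. One-dimensional Lebesgue measure is invariant under it, and Tonelli
  carries this to the product. Sign changes are the case \<open>e = -1\<close>, shears the case
  \<open>e = 1\<close>.\<close>

lemma distr_lborel_PiM_coordinate: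
  fixes h :: "(nat \<Rightarrow> real) \<Rightarrow> real" and e :: real
  assumes i: "i \<le> n" and e: "\<bar>e\<bar> = 1"
    and h[measurable]: "h \<in> borel_measurable (lborel_PiM n)"
    and hi: "\<And>x y. h (x(i := y)) = h x"
  defines "T \<equiv> \<lambda>x. x(i := e * x i + h x)"
  shows "T \<in> lborel_PiM n \<rightarrow>\<^sub>M lborel_PiM n" "distr (lborel_PiM n) (lborel_PiM n) T = lborel_PiM n"
proof -
  have *: "{..n} = insert i ({..n} - {i})"
    using i by auto
  have mi[measurable]: "(\<lambda>x. x i) \<in> borel_measurable (lborel_PiM n)"
    using i by simp
  have upd: "(\<lambda>(x, y). x(i := y)) \<in> lborel_PiM n \<Otimes>\<^sub>M lborel \<rightarrow>\<^sub>M lborel_PiM n"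
    using measurable_add_dim[of i "{..n}" "\<lambda>_. lborel :: real measure"] i
    by (simp add: insert_absorb)
  have "(\<lambda>x. (x, e * x i + h x)) \<in> lborel_PiM n \<rightarrow>\<^sub>M lborel_PiM n \<Otimes>\<^sub>M lborel"
    by measurable
  from measurable_compose[OF this upd]
  show T[measurable]: "T \<in> lborel_PiM n \<rightarrow>\<^sub>M lborel_PiM n"
    by (simp add: T_def)
  show "distr (lborel_PiM n) (lborel_PiM n) T = lborel_PiM n"
  proof (rule measure_eqI)
    fix A assume "A \<in> sets (distr (lborel_PiM n) (lborel_PiM n) T)"
    then have A[measurable]: "A \<in> sets (lborel_PiM n)" by simp
    have "emeasure (distr (lborel_PiM n) (lborel_PiM n) T) A
        = (\<integral>\<^sup>+x. indicator A x \<partial>distr (lborel_PiM n) (lborel_PiM n) T)"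
      by simp
    also have "\<dots> = (\<integral>\<^sup>+x. indicator A (T x) \<partial>lborel_PiM n)"
      by (rule nn_integral_distr) auto
    also have "\<dots> = (\<integral>\<^sup>+x. (\<integral>\<^sup>+y. indicator A (T (x(i := y))) \<partial>lborel) \<partial>(\<Pi>\<^sub>M i\<in>{..n} - {i}. lborel))"
      by (rule nn_integral_PiM_section[OF i]) measurable
    also have "\<dots> = (\<integral>\<^sup>+x. (\<integral>\<^sup>+y. indicator A (x(i := y)) \<partial>lborel) \<partial>(\<Pi>\<^sub>M i\<in>{..n} - {i}. lborel))"
    proof (rule nn_integral_cong)
      fix x assume x: "x \<in> space (\<Pi>\<^sub>M i\<in>{..n} - {i}. lborel :: real measure)"
      have "(\<lambda>y. x(i := y)) \<in> lborel \<rightarrow>\<^sub>M lborel_PiM n"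
        using x i by (intro measurable_fun_upd[where J = "{..n} - {i}"]) auto
      from measurable_compose[OF this borel_measurable_indicator[OF A]]
      have "(\<lambda>y. indicator A (x(i := y))) \<in> borel_measurable borel"
        by simp
      from nn_integral_real_affine[OF this, of e "h x"] e
      show "(\<integral>\<^sup>+y. indicator A (T (x(i := y))) \<partial>lborel) = (\<integral>\<^sup>+y. indicator A (x(i := y)) \<partial>lborel)"
        by (simp add: T_def hi add.commute)
    qed
    also have "\<dots> = (\<integral>\<^sup>+x. indicator A x \<partial>lborel_PiM n)"
      by (rule nn_integral_PiM_section[OF i, symmetric]) measurable
    finally show "emeasure (distr (lborel_PiM n) (lborel_PiM n) T) A = emeasure (lborel_PiM n) A"
      by simp
  qed simp
qed

section \<open>Volume-preserving maps: sign changes, shears, plane rotations, transpositions\<close>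

definition vol_preserving :: "nat \<Rightarrow> ((nat \<Rightarrow> real) \<Rightarrow> nat \<Rightarrow> real) \<Rightarrow> bool" where
  "vol_preserving n T \<longleftrightarrow> T \<in> lborel_PiM n \<rightarrow>\<^sub>M lborel_PiM n
     \<and> distr (lborel_PiM n) (lborel_PiM n) T = lborel_PiM n"

lemma vol_preserving_id: "vol_preserving n (\<lambda>x. x)"
  by (simp add: vol_preserving_def distr_id2)

lemma vol_preserving_comp:
  assumes "vol_preserving n S" "vol_preserving n T"
  shows "vol_preserving n (\<lambda>x. S (T x))"
  using assms distr_distr[of S "lborel_PiM n" "lborel_PiM n" T "lborel_PiM n"]
  by (auto simp: vol_preserving_def o_def)

definition flip :: "nat \<Rightarrow> (nat \<Rightarrow> real) \<Rightarrow> nat \<Rightarrow> real" where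
  "flip i x = x(i := - x i)"

definition shear :: "nat \<Rightarrow> nat \<Rightarrow> real \<Rightarrow> (nat \<Rightarrow> real) \<Rightarrow> nat \<Rightarrow> real" where
  "shear i j q x = x(i := x i + q * x j)"

definition rot :: "nat \<Rightarrow> nat \<Rightarrow> real \<Rightarrow> real \<Rightarrow> (nat \<Rightarrow> real) \<Rightarrow> nat \<Rightarrow> real" where
  "rot i j c s x = x(i := c * x i - s * x j, j := s * x i + c * x j)"

lemma vol_preserving_flip: "i \<le> n \<Longrightarrow> vol_preserving n (flip i)"
  using distr_lborel_PiM_coordinate[of i n "-1" "\<lambda>_. 0"]
  by (simp add: vol_preserving_def flip_def[abs_def])

lemma vol_preserving_shear:
  assumes "i \<le> n" "j \<le> n" "i \<noteq> j"
  shows "vol_preserving n (shear i j q)"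
  using distr_lborel_PiM_coordinate[of i n "1" "\<lambda>x. q * x j"] assms
  by (simp add: vol_preserving_def shear_def[abs_def])

text \<open>A rotation with nonzero sine is a product of three shears. If the sine vanishes, the
  rotation is the identity or a half turn, which is a product of two sign changes.\<close>

lemma vol_preserving_rot:
  assumes ij: "i \<le> n" "j \<le> n" "i \<noteq> j" and cs: "c\<^sup>2 + s\<^sup>2 = 1"
  shows "vol_preserving n (rot i j c s)"
proof (cases "s = 0")
  case True
  then have "c = 1 \<or> c = -1"
    using cs by (simp add: power2_eq_1_iff)
  then show ?thesis
  proof
    assume "c = 1"
    then have "rot i j c s = (\<lambda>x. x)"
      using True by (auto simp: rot_def fun_eq_iff)
    then show ?thesis by (simp add: vol_preserving_id)
  next
    assume "c = -1"
    then have "rot i j c s = (\<lambda>x. flip i (flip j x))"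
      using True ij by (auto simp: rot_def flip_def fun_eq_iff)
    then show ?thesis using ij
      by (simp add: vol_preserving_comp vol_preserving_flip)
  qed
next
  case False
  \<comment> \<open>For \<open>c = cos u\<close> and \<open>s = sin u\<close> this is minus the
    tangent of \<open>u / 2\<close>. The two identities in \<open>q\<close> are all that the matrix
    factorisation needs.\<close>
  define q where "q = (c - 1) / s"
  have q: "q * s = c - 1" "q * (1 + c) = - s"
    using False cs by (auto simp: q_def field_simps power2_eq_square)
  have "rot i j c s = (\<lambda>x. shear i j q (shear j i s (shear i j q x)))"
  proof (intro ext)
    fix x k
    have c: "c = 1 + q * s" and s: "s = - (q + q * c)"
      using q by (auto simp: algebra_simps)
    have "c * x i - s * x j = x i + q * x j + q * (x j + s * (x i + q * x j))"
      using c s by algebra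
    moreover have "s * x i + c * x j = x j + s * (x i + q * x j)"
      using c by algebra
    ultimately show "rot i j c s x k = shear i j q (shear j i s (shear i j q x)) k"
      using ij by (auto simp: rot_def shear_def)
  qed
  then show ?thesis
    using ij vol_preserving_comp[OF vol_preserving_shear vol_preserving_comp[OF vol_preserving_shear vol_preserving_shear]]
    by simp
qed

definition swap :: "nat \<Rightarrow> nat \<Rightarrow> (nat \<Rightarrow> real) \<Rightarrow> nat \<Rightarrow> real" where
  "swap i j x = x(i := x j, j := x i)"

lemma vol_preserving_swap:
  assumes ij: "i \<le> n" "j \<le> n" "i \<noteq> j"
  shows "vol_preserving n (swap i j)"
proof -
  have "swap i j = (\<lambda>x. flip i (rot i j 0 1 x))"
    using ij by (auto simp: rot_def flip_def swap_def fun_eq_iff)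
  then show ?thesis
    using ij by (simp add: vol_preserving_comp vol_preserving_flip vol_preserving_rot)
qed

section \<open>From Lebesgue measure to the measure on the sphere\<close>

lemma sets_PiM_borel_lborel: "sets (\<Pi>\<^sub>M i\<in>{..n}. borel :: real measure) = sets (lborel_PiM n)"
  by (rule sets_PiM_cong) auto

lemma space_lborel_PiM: "space (lborel_PiM n) = {..n} \<rightarrow>\<^sub>E UNIV"
  by (simp add: space_PiM)

lemma sets_sphere_measure: "sets (sphere_measure n) = sets (restrict_space (lborel_PiM n) (unit_sphere n))"
  by (simp add: sphere_measure_def sets_restrict_space sets_PiM_borel_lborel)

text \<open>Unfolding the image measure and the uniform measure leaves a quotient of two Lebesgue
  volumes, that of the cone over \<open>A\<close> and that of the ball. In this form
  volume-preserving maps can be applied.\<close>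

lemma emeasure_sphere_measure:
  assumes A: "A \<in> sets (lborel_PiM n)"
  shows "emeasure (sphere_measure n) (A \<inter> unit_sphere n) =
    emeasure (lborel_PiM n) {x \<in> punctured_ball n. radial_proj n x \<in> A} /
    emeasure (lborel_PiM n) (punctured_ball n)"
proof -
  let ?M = "lborel_PiM n" and ?B = "punctured_ball n"
  have B: "?B \<inter> space ?M \<in> sets ?M" "?B \<subseteq> space ?M"
    using punctured_ball_sets[of n] sets.sets_into_space by auto
  have AS: "A \<inter> unit_sphere n \<in> sets (restrict_space (\<Pi>\<^sub>M i\<in>{..n}. borel) (unit_sphere n))"
    using A by (auto simp: sets_restrict_space sets_PiM_borel_lborel)
  have sp: "space (restrict_space ?M ?B) = ?B"
    using B by (auto simp: space_restrict_space)
  have pre: "radial_proj n -` (A \<inter> unit_sphere n) \<inter> ?B = {x \<in> ?B. radial_proj n x \<in> A}"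
    using radial_proj_in_unit_sphere by auto
  have pre_sets: "{x \<in> ?B. radial_proj n x \<in> A} \<in> sets (restrict_space ?M ?B)"
    using measurable_sets[OF radial_proj_measurable AS] by (simp only: sp pre)
  have "emeasure (sphere_measure n) (A \<inter> unit_sphere n)
      = emeasure (uniform_measure (restrict_space ?M ?B) ?B) {x \<in> ?B. radial_proj n x \<in> A}"
    unfolding sphere_measure_def
    by (subst emeasure_distr) (use AS radial_proj_measurable sp pre in auto)
  also have "\<dots> = emeasure (restrict_space ?M ?B) (?B \<inter> {x \<in> ?B. radial_proj n x \<in> A})
       / emeasure (restrict_space ?M ?B) ?B"
    by (rule emeasure_uniform_measure) (use pre_sets sets.top[of "restrict_space ?M ?B"] sp in auto)
  also have "?B \<inter> {x \<in> ?B. radial_proj n x \<in> A} = {x \<in> ?B. radial_proj n x \<in> A}"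
    by auto
  finally show ?thesis
    using B by (simp add: emeasure_restrict_space subset_iff)
qed

text \<open>Since \<open>T\<close> preserves the norm and commutes with \<open>radial_proj\<close>,
  the cone over a preimage is the preimage of the cone, and both cones have the same volume. So
  \<open>T\<close> maps the spherical measure to itself.\<close>

lemma integral_sphere_measure_invariant:
  assumes T: "vol_preserving n T"
    and norm: "\<And>x. eucl_norm n (T x) = eucl_norm n x"
    and proj: "\<And>x. x \<in> {..n} \<rightarrow>\<^sub>E UNIV \<Longrightarrow> radial_proj n (T x) = T (radial_proj n x)"
    and f: "f \<in> borel_measurable (lborel_PiM n)"
  shows "(\<integral>x. f (T x) \<partial>sphere_measure n) = (\<integral>x. (f x :: real) \<partial>sphere_measure n)"
proof -
  let ?M = "lborel_PiM n" and ?B = "punctured_ball n" and ?S = "sphere_measure n"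
  have TM[measurable]: "T \<in> ?M \<rightarrow>\<^sub>M ?M" and dT: "distr ?M ?M T = ?M"
    using T by (auto simp: vol_preserving_def)
  have Tsp: "T x \<in> {..n} \<rightarrow>\<^sub>E UNIV" if "x \<in> {..n} \<rightarrow>\<^sub>E UNIV" for x
    using measurable_space[OF TM] that by (simp add: space_lborel_PiM)
  have TS: "T \<in> ?S \<rightarrow>\<^sub>M ?S"
  proof -
    have "T \<in> restrict_space ?M (unit_sphere n) \<rightarrow>\<^sub>M restrict_space ?M (unit_sphere n)"
      by (rule measurable_restrict_space3[OF TM]) (use norm Tsp in \<open>auto simp: unit_sphere_def\<close>)
    then show ?thesis
      by (simp cong: measurable_cong_sets add: sets_sphere_measure)
  qed
  have fS: "f \<in> borel_measurable ?S"
    using measurable_restrict_space1[OF f, of "unit_sphere n"]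
    by (simp cong: measurable_cong_sets add: sets_sphere_measure)
  have "distr ?S ?S T = ?S"
  proof (rule measure_eqI)
    fix A assume "A \<in> sets (distr ?S ?S T)"
    then obtain A' where A': "A' \<in> sets ?M" "A = A' \<inter> unit_sphere n"
      by (auto simp: sets_sphere_measure sets_restrict_space)
    let ?C = "T -` A' \<inter> space ?M"
    have C: "?C \<in> sets ?M" using A' by measurable
    have D: "{x \<in> ?B. radial_proj n x \<in> A'} \<in> sets ?M"
    proof -
      have "radial_proj n \<in> ?M \<rightarrow>\<^sub>M ?M"
        unfolding radial_proj_def by measurable
      then have "radial_proj n -` A' \<inter> space ?M \<inter> ?B \<in> sets ?M"
        using A' punctured_ball_sets by (metis measurable_sets sets.Int)
      moreover have "radial_proj n -` A' \<inter> space ?M \<inter> ?B = {x \<in> ?B. radial_proj n x \<in> A'}"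
        using sets.sets_into_space[OF punctured_ball_sets] by auto
      ultimately show ?thesis by simp
    qed
    have "emeasure (distr ?S ?S T) A = emeasure ?S (T -` A \<inter> space ?S)"
      using A' TS by (intro emeasure_distr) (auto simp: sets_sphere_measure sets_restrict_space)
    also have "T -` A \<inter> space ?S = ?C \<inter> unit_sphere n"
      using A' norm Tsp by (auto simp: space_sphere_measure space_lborel_PiM unit_sphere_def)
    also have "emeasure ?S \<dots> = emeasure ?M {x \<in> ?B. radial_proj n x \<in> ?C} / emeasure ?M ?B"
      by (rule emeasure_sphere_measure[OF C])
    \<comment> \<open>Both hypotheses enter here: \<open>proj\<close> interchanges \<open>T\<close>
      with the projection, and \<open>norm\<close> keeps the ball in place.\<close>
    also have "{x \<in> ?B. radial_proj n x \<in> ?C} = T -` {x \<in> ?B. radial_proj n x \<in> A'} \<inter> space ?M"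
    proof -
      have "radial_proj n x \<in> {..n} \<rightarrow>\<^sub>E UNIV" for x by (simp add: radial_proj_def)
      then show ?thesis
        using proj norm by (auto simp: punctured_ball_def space_lborel_PiM dest: Tsp simp del: PiE_UNIV_domain)
    qed
    also have "emeasure ?M \<dots> = emeasure (distr ?M ?M T) {x \<in> ?B. radial_proj n x \<in> A'}"
      using D by (simp add: emeasure_distr)
    also have "\<dots> / emeasure ?M ?B = emeasure ?S A"
      using emeasure_sphere_measure[OF A'(1)] A' by (simp add: dT)
    finally show "emeasure (distr ?S ?S T) A = emeasure ?S A" .
  qed simp
  then have "(\<integral>x. f x \<partial>?S) = (\<integral>x. f x \<partial>distr ?S ?S T)" by simp
  also have "\<dots> = (\<integral>x. f (T x) \<partial>?S)"
    by (rule integral_distr[OF TS fS])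
  finally show ?thesis by simp
qed

lemma unit_sphere_abs_le_1:
  assumes "x \<in> unit_sphere n" "i \<le> n"
  shows "\<bar>x i\<bar> \<le> 1"
proof -
  have "(x i)\<^sup>2 \<le> (\<Sum>i\<le>n. (x i)\<^sup>2)"
    using assms by (intro member_le_sum) auto
  also have "\<dots> = 1"
    using assms by (simp add: unit_sphere_def eucl_norm_def)
  finally show ?thesis
    by (simp add: abs_square_le_1)
qed

lemma unit_sphere_sum_squares: "x \<in> unit_sphere n \<Longrightarrow> (\<Sum>i\<le>n. (x i)\<^sup>2) = 1"
  by (simp add: unit_sphere_def eucl_norm_def)

lemma borel_measurable_sphere_measure:
  "f \<in> borel_measurable (lborel_PiM n) \<Longrightarrow> f \<in> borel_measurable (sphere_measure n)"
  using measurable_restrict_space1[of f "lborel_PiM n" borel "unit_sphere n"]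
    measurable_cong_sets[OF sets_sphere_measure refl] by blast

lemma integrable_sphere_measure_bounded:
  fixes f :: "(nat \<Rightarrow> real) \<Rightarrow> real"
  assumes "f \<in> borel_measurable (lborel_PiM n)" "\<And>x. x \<in> unit_sphere n \<Longrightarrow> \<bar>f x\<bar> \<le> K"
  shows "integrable (sphere_measure n) f"
proof -
  interpret prob_space "sphere_measure n"
    by (rule prob_space_sphere_measure)
  show ?thesis
    using assms(2) borel_measurable_sphere_measure[OF assms(1)]
    by (intro integrable_const_bound[where B = K]) (auto simp: space_sphere_measure)
qed

abbreviation monomial :: "nat \<Rightarrow> (nat \<Rightarrow> nat) \<Rightarrow> (nat \<Rightarrow> real) \<Rightarrow> real" where
  "monomial n \<alpha> x \<equiv> \<Prod>i\<le>n. x i ^ \<alpha> i"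

lemma monomial_measurable: "monomial n \<alpha> \<in> borel_measurable (lborel_PiM n)"
  by measurable

lemma integrable_monomial: "integrable (sphere_measure n) (monomial n \<alpha>)"
proof (rule integrable_sphere_measure_bounded[where K = 1])
  fix x assume "x \<in> unit_sphere n"
  then show "\<bar>monomial n \<alpha> x\<bar> \<le> 1"
    unfolding abs_prod power_abs using unit_sphere_abs_le_1
    by (intro prod_le_1) (auto intro: power_le_one)
qed (rule monomial_measurable)

section \<open>Invariance of spherical integrals under the concrete symmetries\<close>

lemma integral_sphere_flip:
  assumes i: "i \<le> n" and f: "f \<in> borel_measurable (lborel_PiM n)"
  shows "(\<integral>x. f (flip i x) \<partial>sphere_measure n) = (\<integral>x. (f x :: real) \<partial>sphere_measure n)"
proof (rule integral_sphere_measure_invariant[OF vol_preserving_flip[OF i] _ _ f])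
  show norm: "eucl_norm n (flip i x) = eucl_norm n x" for x
    unfolding eucl_norm_def by (intro arg_cong[of _ _ sqrt] sum.cong) (auto simp: flip_def)
  show "radial_proj n (flip i x) = flip i (radial_proj n x)" for x
    using i by (auto simp: radial_proj_def norm fun_eq_iff) (auto simp: flip_def)
qed

lemma integral_sphere_swap:
  assumes i: "i \<le> n" "j \<le> n" "i \<noteq> j" and f: "f \<in> borel_measurable (lborel_PiM n)"
  shows "(\<integral>x. f (swap i j x) \<partial>sphere_measure n) = (\<integral>x. (f x :: real) \<partial>sphere_measure n)"
proof (rule integral_sphere_measure_invariant[OF vol_preserving_swap[OF i] _ _ f])
  show norm: "eucl_norm n (swap i j x) = eucl_norm n x" for x
  proof -
    have *: "{..n} = insert i (insert j ({..n} - {i, j}))" using i by auto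
    have "(\<Sum>k\<in>{..n} - {i, j}. (swap i j x k)\<^sup>2) = (\<Sum>k\<in>{..n} - {i, j}. (x k)\<^sup>2)"
      by (intro sum.cong) (auto simp: swap_def)
    then show ?thesis
      unfolding eucl_norm_def using i by (subst (1 2) *) (simp add: swap_def)
  qed
  show "radial_proj n (swap i j x) = swap i j (radial_proj n x)" for x
    using i by (auto simp: radial_proj_def norm fun_eq_iff) (auto simp: swap_def)
qed

lemma integral_sphere_rot:
  assumes i: "i \<le> n" "j \<le> n" "i \<noteq> j" "c\<^sup>2 + s\<^sup>2 = 1" and f: "f \<in> borel_measurable (lborel_PiM n)"
  shows "(\<integral>x. f (rot i j c s x) \<partial>sphere_measure n) = (\<integral>x. (f x :: real) \<partial>sphere_measure n)"
proof (rule integral_sphere_measure_invariant[OF vol_preserving_rot[OF i] _ _ f])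
  show norm: "eucl_norm n (rot i j c s x) = eucl_norm n x" for x
  proof -
    have *: "{..n} = insert i (insert j ({..n} - {i, j}))" using i by auto
    have 1: "(\<Sum>k\<in>{..n} - {i, j}. (rot i j c s x k)\<^sup>2) = (\<Sum>k\<in>{..n} - {i, j}. (x k)\<^sup>2)"
      by (intro sum.cong) (auto simp: rot_def)
    have "(c * x i - s * x j)\<^sup>2 + (s * x i + c * x j)\<^sup>2 = (c\<^sup>2 + s\<^sup>2) * ((x i)\<^sup>2 + (x j)\<^sup>2)"
      by algebra
    with 1 show ?thesis
      unfolding eucl_norm_def using i by (subst (1 2) *) (simp add: rot_def)
  qed
  show "radial_proj n (rot i j c s x) = rot i j c s (radial_proj n x)" for x
    using i by (auto simp: radial_proj_def norm fun_eq_iff) (auto simp: rot_def diff_divide_distrib add_divide_distrib)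
qed

text \<open>Changing the sign of coordinate \<open>i\<close> negates the monomial but not the
  integral.\<close>

lemma integral_odd_monomial:
  assumes i: "i \<le> n" "odd (\<alpha> i)"
  shows "(\<integral>x. monomial n \<alpha> x \<partial>sphere_measure n) = 0"
proof -
  have "monomial n \<alpha> (flip i x) = - monomial n \<alpha> x" for x
  proof -
    have "(\<Prod>k\<in>{..n} - {i}. flip i x k ^ \<alpha> k) = (\<Prod>k\<in>{..n} - {i}. x k ^ \<alpha> k)"
      by (intro prod.cong) (auto simp: flip_def)
    then show ?thesis
      using i by (subst (1 2) prod.remove[of _ i]) (auto simp: flip_def)
  qed
  then show ?thesis
    using integral_sphere_flip[OF i(1) monomial_measurable[where n = n and \<alpha> = \<alpha>]] by simp
qed

section \<open>Cubature formulas from weighted families of points\<close>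

text \<open>By linearity it is enough to test monomials. The index set allows repetitions:
  \<open>g\<close> need not be injective, and a point receives the sum of the \<open>h t\<close>
  over its fibre, so no orbit ever has to be checked for coincidences.\<close>

lemma is_cubature_family:
  fixes h :: "'t \<Rightarrow> real"
  assumes T: "finite T" "g ` T \<subseteq> unit_sphere n"
    and eq: "\<And>\<alpha>. \<alpha> \<in> multi_indices n d \<Longrightarrow>
      (\<integral>x. monomial n \<alpha> x \<partial>sphere_measure n) = (\<Sum>t\<in>T. h t * monomial n \<alpha> (g t))"
  shows "is_cubature n d (g ` T) (\<lambda>p. \<Sum>t\<in>{t\<in>T. g t = p}. h t)"
  unfolding is_cubature_def
proof (intro conjI allI impI)
  fix P assume "poly_deg_le n d P"
  then obtain c where P: "\<And>x. P x = (\<Sum>\<alpha>\<in>multi_indices n d. c \<alpha> * monomial n \<alpha> x)"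
    by (auto simp: poly_deg_le_def)
  have "(\<integral>x. P x \<partial>sphere_measure n) = (\<Sum>\<alpha>\<in>multi_indices n d. c \<alpha> * (\<integral>x. monomial n \<alpha> x \<partial>sphere_measure n))"
    unfolding P using integrable_monomial[of n] by (simp add: Bochner_Integration.integral_sum)
  also have "\<dots> = (\<Sum>\<alpha>\<in>multi_indices n d. c \<alpha> * (\<Sum>t\<in>T. h t * monomial n \<alpha> (g t)))"
    using eq by simp
  also have "\<dots> = (\<Sum>t\<in>T. h t * P (g t))"
    unfolding P sum_distrib_left by (subst sum.swap) (simp only: mult.left_commute)
  also have "\<dots> = (\<Sum>p\<in>g ` T. \<Sum>t\<in>{t\<in>T. g t = p}. h t * P (g t))"
    by (rule sum.image_gen[OF T(1)])
  also have "\<dots> = (\<Sum>p\<in>g ` T. (\<Sum>t\<in>{t\<in>T. g t = p}. h t) * P p)"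
    unfolding sum_distrib_right by (intro sum.cong refl) simp
  finally show "(\<integral>x. P x \<partial>sphere_measure n) = \<dots>" .
qed (use T in auto)

text \<open>Supplies the fresh points for padding. The bound on \<open>n\<close> is essential,
  because the sphere for \<open>n = 0\<close> has two points.\<close>

lemma infinite_unit_sphere:
  assumes "1 \<le> n"
  shows "infinite (unit_sphere n)"
proof -
  define f :: "real \<Rightarrow> nat \<Rightarrow> real" where
    "f y = (\<lambda>i\<in>{..n}. if i = 0 then y else if i = 1 then sqrt (1 - y\<^sup>2) else 0)" for y
  have "f y \<in> unit_sphere n" if "y \<in> {0..1}" for y
  proof -
    have "y\<^sup>2 \<le> 1" using that by (simp add: power_le_one)
    have "(\<Sum>i\<le>n. (f y i)\<^sup>2) = (\<Sum>i\<in>{0,1}. (f y i)\<^sup>2)"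
      using assms by (intro sum.mono_neutral_right) (auto simp: f_def)
    also have "\<dots> = 1" using assms \<open>y\<^sup>2 \<le> 1\<close> by (simp add: f_def)
    finally show ?thesis by (simp add: unit_sphere_def eucl_norm_def f_def)
  qed
  then have "f ` {0..1} \<subseteq> unit_sphere n" by auto
  moreover have "inj_on f {0..1}"
  proof (rule inj_onI)
    fix y z assume "f y = f z"
    then have "f y 0 = f z 0" by simp
    then show "y = z" by (simp add: f_def)
  qed
  then have "infinite (f ` {0..1})"
    using finite_imageD infinite_Icc[OF zero_less_one] by blast
  ultimately show ?thesis
    using finite_subset by blast
qed

text \<open>Additional points with weight 0 leave the formula valid, so an upper bound on the number
  of points becomes an exact count.\<close>

lemma is_cubature_pad:
  assumes F: "is_cubature n d F w" and "1 \<le> n" "card F \<le> N"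
  shows "\<exists>F w. is_cubature n d F w \<and> card F = N"
proof -
  have fin: "finite F" using F by (simp add: is_cubature_def)
  have "infinite (unit_sphere n - F)"
    using infinite_unit_sphere[OF assms(2)] fin by simp
  then obtain G where G: "finite G" "card G = N - card F" "G \<subseteq> unit_sphere n - F"
    using infinite_arbitrarily_large by metis
  have "is_cubature n d (F \<union> G) (\<lambda>p. if p \<in> F then w p else 0)"
    unfolding is_cubature_def
  proof (intro conjI allI impI)
    fix P assume "poly_deg_le n d P"
    then have "(\<integral>x. P x \<partial>sphere_measure n) = (\<Sum>p\<in>F. w p * P p)"
      using F by (simp add: is_cubature_def)
    also have "\<dots> = (\<Sum>p\<in>F \<union> G. (if p \<in> F then w p else 0) * P p)"
      using fin G by (intro sum.mono_neutral_cong_left) auto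
    finally show "(\<integral>x. P x \<partial>sphere_measure n) = \<dots>" .
  qed (use F G in \<open>auto simp: is_cubature_def\<close>)
  moreover have "card (F \<union> G) = N"
    using fin G assms by (subst card_Un_disjoint) auto
  ultimately show ?thesis by blast
qed

section \<open>Degree 7\<close>

text \<open>The inclusion matrix is unitriangular. Induction removes a member \<open>V0\<close> of
  least cardinality: the only member contained in \<open>V0\<close> is \<open>V0\<close> itself, so
  the unknown \<open>c V0\<close> occurs in no equation but that of \<open>V0\<close> and can be
  chosen last.\<close>

lemma triangular_system_superset:
  fixes m :: "'a set \<Rightarrow> real"
  assumes "finite \<F>" "\<And>U. U \<in> \<F> \<Longrightarrow> finite U"
  shows "\<exists>c. \<forall>V\<in>\<F>. (\<Sum>U | U \<in> \<F> \<and> V \<subseteq> U. c U) = m V"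
  using assms
proof (induction "card \<F>" arbitrary: \<F>)
  case 0
  then show ?case by auto
next
  case (Suc k)
  then have "\<F> \<noteq> {}" by auto
  then obtain V0 where V0: "V0 \<in> \<F>" "\<And>V. V \<in> \<F> \<Longrightarrow> card V0 \<le> card V"
    using ex_has_least_nat[of "\<lambda>V. V \<in> \<F>" _ card] by blast
  have min: "V = V0" if "V \<in> \<F>" "V \<subseteq> V0" for V
    using that V0 Suc.prems card_seteq[of V0 V] by simp
  have "k = card (\<F> - {V0})" "finite (\<F> - {V0})"
    using Suc V0 by auto
  from Suc.hyps(1)[OF this] Suc.prems obtain c where
    c: "\<And>V. V \<in> \<F> - {V0} \<Longrightarrow> (\<Sum>U | U \<in> \<F> - {V0} \<and> V \<subseteq> U. c U) = m V"
    by blast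
  define c' where "c' = c(V0 := m V0 - (\<Sum>U | U \<in> \<F> - {V0} \<and> V0 \<subseteq> U. c U))"
  have "(\<Sum>U | U \<in> \<F> \<and> V \<subseteq> U. c' U) = m V" if V: "V \<in> \<F>" for V
  proof (cases "V = V0")
    case True
    have "{U. U \<in> \<F> \<and> V0 \<subseteq> U} = insert V0 {U. U \<in> \<F> - {V0} \<and> V0 \<subseteq> U}"
      using V0 by auto
    moreover have "(\<Sum>U | U \<in> \<F> - {V0} \<and> V0 \<subseteq> U. c' U) = (\<Sum>U | U \<in> \<F> - {V0} \<and> V0 \<subseteq> U. c U)"
      by (intro sum.cong) (auto simp: c'_def)
    ultimately show ?thesis
      using True Suc.prems by (simp add: c'_def)
  next
    case False
    then have "{U. U \<in> \<F> \<and> V \<subseteq> U} = {U. U \<in> \<F> - {V0} \<and> V \<subseteq> U}"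
      using V min by auto
    moreover have "(\<Sum>U | U \<in> \<F> - {V0} \<and> V \<subseteq> U. c' U) = (\<Sum>U | U \<in> \<F> - {V0} \<and> V \<subseteq> U. c U)"
      by (intro sum.cong) (auto simp: c'_def)
    ultimately show ?thesis
      using V False c by simp
  qed
  then show ?case by blast
qed

section \<open>Moments of products of squared coordinates\<close>

definition sq_prod :: "nat list \<Rightarrow> (nat \<Rightarrow> real) \<Rightarrow> real" where
  "sq_prod is x = (\<Prod>i\<leftarrow>is. (x i)\<^sup>2)"

lemma sq_prod_simps [simp]: "sq_prod [] x = 1" "sq_prod (i # is) x = (x i)\<^sup>2 * sq_prod is x"
  by (auto simp: sq_prod_def)

text \<open>Induction on half the degree: a coordinate with nonzero even exponent has exponent at
  least 2, so one of its squares splits off.\<close>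

lemma even_monomial_eq_sq_prod:
  assumes "\<And>i. i \<le> n \<Longrightarrow> even (\<alpha> i)" "(\<Sum>i\<le>n. \<alpha> i) = 2 * d"
  shows "\<exists>is. length is = d \<and> set is \<subseteq> {..n} \<and> (\<forall>x. monomial n \<alpha> x = sq_prod is x)"
  using assms
proof (induction d arbitrary: \<alpha>)
  case 0
  then show ?case by (intro exI[of _ "[]"]) auto
next
  case (Suc d)
  have "\<exists>i\<le>n. \<alpha> i \<noteq> 0"
  proof (rule ccontr)
    assume "\<not> ?thesis"
    then have "(\<Sum>i\<le>n. \<alpha> i) = 0" by simp
    with Suc.prems show False by simp
  qed
  then obtain i where i: "i \<le> n" "\<alpha> i \<noteq> 0" by blast
  have "2 \<le> \<alpha> i"
    using Suc.prems(1)[OF i(1)] i(2) by presburger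
  then obtain k where k: "\<alpha> i = k + 2"
    by (metis add.commute le_Suc_ex)
  define \<beta> where "\<beta> = \<alpha>(i := k)"
  have "(\<Sum>i\<le>n. \<beta> i) = 2 * d"
  proof -
    have "(\<Sum>j\<in>{..n} - {i}. \<beta> j) = (\<Sum>j\<in>{..n} - {i}. \<alpha> j)"
      by (intro sum.cong) (auto simp: \<beta>_def)
    moreover have "(\<Sum>i\<le>n. \<alpha> i) = \<alpha> i + (\<Sum>j\<in>{..n} - {i}. \<alpha> j)" "(\<Sum>i\<le>n. \<beta> i) = \<beta> i + (\<Sum>j\<in>{..n} - {i}. \<beta> j)"
      using i by (auto intro!: sum.remove)
    ultimately show ?thesis using Suc.prems(2) k by (simp add: \<beta>_def)
  qed
  moreover have "even (\<beta> j)" if "j \<le> n" for j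
    using Suc.prems(1)[OF that] k by (auto simp: \<beta>_def)
  ultimately obtain "is" where "is": "length is = d" "set is \<subseteq> {..n}" "\<And>x. monomial n \<beta> x = sq_prod is x"
    using Suc.IH[of \<beta>] by blast
  have "monomial n \<alpha> x = (x i)\<^sup>2 * monomial n \<beta> x" for x
  proof -
    have "(\<Prod>j\<in>{..n} - {i}. x j ^ \<beta> j) = (\<Prod>j\<in>{..n} - {i}. x j ^ \<alpha> j)"
      by (intro prod.cong) (auto simp: \<beta>_def)
    moreover have "monomial n \<alpha> x = x i ^ \<alpha> i * (\<Prod>j\<in>{..n} - {i}. x j ^ \<alpha> j)"
      "monomial n \<beta> x = x i ^ \<beta> i * (\<Prod>j\<in>{..n} - {i}. x j ^ \<beta> j)"
      using i by (auto intro!: prod.remove)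
    ultimately show ?thesis using k by (simp add: \<beta>_def power2_eq_square)
  qed
  with i "is" show ?case
    by (intro exI[of _ "i # is"]) auto
qed

lemma sq_prod_measurable:
  "set is \<subseteq> {..n} \<Longrightarrow> sq_prod is \<in> borel_measurable (lborel_PiM n)"
proof (induction "is")
  case (Cons i "is")
  then have [measurable]: "sq_prod is \<in> borel_measurable (lborel_PiM n)" "(\<lambda>x. x i) \<in> borel_measurable (lborel_PiM n)"
    by auto
  have "(\<lambda>x. (x i)\<^sup>2 * sq_prod is x) \<in> borel_measurable (lborel_PiM n)"
    by measurable
  also have "(\<lambda>x. (x i)\<^sup>2 * sq_prod is x) = sq_prod (i # is)" by auto
  finally show ?case .
next
  case Nil
  have "sq_prod [] = (\<lambda>_. 1)" by auto
  then show ?case by simp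
qed

lemma integrable_sq_prod:
  assumes "set is \<subseteq> {..n}"
  shows "integrable (sphere_measure n) (sq_prod is)"
proof (rule integrable_sphere_measure_bounded[where K = 1])
  fix x assume x: "x \<in> unit_sphere n"
  show "\<bar>sq_prod is x\<bar> \<le> 1"
    using assms
  proof (induction "is")
    case (Cons i "is")
    then have "\<bar>(x i)\<^sup>2\<bar> * \<bar>sq_prod is x\<bar> \<le> 1 * 1"
      using unit_sphere_abs_le_1[OF x, of i] by (intro mult_mono) (auto simp: abs_square_le_1)
    then show ?case by (simp add: abs_mult)
  qed simp
qed (rule sq_prod_measurable[OF assms])

text \<open>On the sphere the squared coordinates sum to 1, so inserting that sum changes nothing.
  Hence the moments with three squares determine those with fewer.\<close>

lemma integral_sq_prod_Cons:
  assumes "set is \<subseteq> {..n}"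
  shows "(\<integral>x. sq_prod is x \<partial>sphere_measure n) = (\<Sum>i\<le>n. \<integral>x. sq_prod (i # is) x \<partial>sphere_measure n)"
proof -
  have "(\<Sum>i\<le>n. \<integral>x. sq_prod (i # is) x \<partial>sphere_measure n) = (\<integral>x. (\<Sum>i\<le>n. sq_prod (i # is) x) \<partial>sphere_measure n)"
    using assms by (intro Bochner_Integration.integral_sum[symmetric] integrable_sq_prod) auto
  also have "\<dots> = (\<integral>x. sq_prod is x \<partial>sphere_measure n)"
    by (intro Bochner_Integration.integral_cong refl)
       (simp add: space_sphere_measure unit_sphere_sum_squares flip: sum_distrib_right)
  finally show ?thesis by simp
qed

text \<open>\<open>c1\<close> and \<open>c2\<close> are commutativity of multiplication and permute
  the list. With two distinct indices one also has to know which of them is repeated;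
  \<open>sw\<close> removes this dependence by a transposition of coordinates, and it is the only
  place where invariance of the measure is used.\<close>

lemma integral_sq_prod_set:
  assumes "{i, j, k} = {i', j', k'}" "{i, j, k} \<subseteq> {..n}"
  shows "(\<integral>x. sq_prod [i, j, k] x \<partial>sphere_measure n) = (\<integral>x. sq_prod [i', j', k'] x \<partial>sphere_measure n)"
proof -
  define g where "g i j k = (\<integral>x. sq_prod [i, j, k] x \<partial>sphere_measure n)" for i j k
  have c1: "g i j k = g j i k" and c2: "g i j k = g i k j" for i j k
    by (simp_all add: g_def mult.left_commute mult.commute)
  have sw: "g i i j = g i j j" if "i \<le> n" "j \<le> n" for i j
  proof (cases "i = j")
    case False
    have "g j j i = (\<integral>x. sq_prod [i, i, j] (swap i j x) \<partial>sphere_measure n)"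
      unfolding g_def using False by (intro Bochner_Integration.integral_cong refl) (simp add: swap_def)
    also have "\<dots> = g i i j"
      unfolding g_def by (rule integral_sphere_swap[OF that False sq_prod_measurable]) (use that in auto)
    finally show ?thesis using c2[of j j i] c1[of j i j] by simp
  qed simp
  have "g i j k = g i' j' k'"
  proof (cases "i = j \<or> j = k \<or> i = k")
    case False
    then have "card {i, j, k} = 3" by simp
    then have "card {i', j', k'} = 3" by (simp only: assms(1))
    then have "i' \<noteq> j'" "j' \<noteq> k'" "i' \<noteq> k'" by (auto simp: card_insert_if split: if_splits)
    moreover have "i' \<in> {i, j, k}" "j' \<in> {i, j, k}" "k' \<in> {i, j, k}"
      using assms(1) by auto
    ultimately have "(i', j', k') \<in> {(i,j,k),(i,k,j),(j,i,k),(j,k,i),(k,i,j),(k,j,i)}"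
      by blast
    then show ?thesis
      using c2[of i k j] c1[of j i k] c2[of j k i] c1[of k i j] c1[of k j i] by fastforce
  next
    case True
    then obtain a b where ab: "{i, j, k} = {a, b}" by auto
    then have "{a, b} \<subseteq> {..n}" using assms(2) by simp
    then have le: "a \<le> n" "b \<le> n" by auto
    have "g u v w = g a a b" if "{u, v, w} = {a, b}" for u v w
    proof -
      have "u \<in> {a, b}" "v \<in> {a, b}" "w \<in> {a, b}" "a \<in> {u, v, w}" "b \<in> {u, v, w}"
        using that by auto
      then show ?thesis
        using c2[of a b a] c1[of b a a] sw[OF le, symmetric] c1[of b a b] c2[of b b a] by auto
    qed
    then show ?thesis using ab assms(1) by metis
  qed
  then show ?thesis by (simp only: g_def)
qed

section \<open>Signed points supported on at most three coordinates\<close>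

definition sign_point :: "nat \<Rightarrow> nat set \<Rightarrow> nat set \<Rightarrow> nat \<Rightarrow> real" where
  "sign_point n U S = (\<lambda>i\<in>{..n}. if i \<in> U then (if i \<in> S then -1 else 1) / sqrt (card U) else 0)"

lemma sign_point_sq:
  assumes "U \<subseteq> {..n}" "i \<le> n"
  shows "(sign_point n U S i)\<^sup>2 = (if i \<in> U then 1 / card U else 0)"
  using assms by (simp add: sign_point_def power_divide)

lemma sign_point_in_sphere:
  assumes "U \<subseteq> {..n}" "U \<noteq> {}"
  shows "sign_point n U S \<in> unit_sphere n"
proof -
  have fin: "finite U" using assms finite_subset by blast
  have "(\<Sum>i\<le>n. (sign_point n U S i)\<^sup>2) = (\<Sum>i\<le>n. if i \<in> U then 1 / card U else 0)"
    by (intro sum.cong refl sign_point_sq assms) simp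
  also have "\<dots> = (\<Sum>i\<in>U. 1 / card U)"
    using assms by (simp add: sum.If_cases Int_absorb1)
  also have "\<dots> = 1" using fin assms by simp
  finally show ?thesis
    by (auto simp: unit_sphere_def eucl_norm_def sign_point_def)
qed

text \<open>If \<open>i\<close> lies in \<open>U\<close>, toggling membership of \<open>i\<close> in
  \<open>S\<close> is an involution that negates each summand. Otherwise every summand is 0, since
  coordinate \<open>i\<close> vanishes and an odd exponent is positive.\<close>

lemma sum_sign_point_odd_monomial:
  assumes U: "U \<subseteq> {..n}" and i: "i \<le> n" "odd (\<alpha> i)"
  shows "(\<Sum>S\<in>Pow U. monomial n \<alpha> (sign_point n U S)) = 0"
proof (cases "i \<in> U")
  case False
  have "monomial n \<alpha> (sign_point n U S) = 0" for S
    using i False by (intro prod_zero bexI[of _ i]) (auto simp: sign_point_def odd_pos)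
  then show ?thesis by (simp only: sum.neutral_const)
next
  case True
  define t where "t S = (if i \<in> S then S - {i} else insert i S)" for S
  have "monomial n \<alpha> (sign_point n U (t S)) = - monomial n \<alpha> (sign_point n U S)" for S
  proof -
    have "(\<Prod>k\<in>{..n} - {i}. sign_point n U (t S) k ^ \<alpha> k) = (\<Prod>k\<in>{..n} - {i}. sign_point n U S k ^ \<alpha> k)"
      by (intro prod.cong refl) (auto simp: sign_point_def t_def)
    moreover have "sign_point n U (t S) i = - sign_point n U S i"
      using True i by (auto simp: sign_point_def t_def)
    ultimately show ?thesis
      using i by (subst (1 2) prod.remove[of _ i]) auto
  qed
  moreover have "(\<Sum>S\<in>Pow U. monomial n \<alpha> (sign_point n U (t S))) = (\<Sum>S\<in>Pow U. monomial n \<alpha> (sign_point n U S))"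
    using True by (intro sum.reindex_bij_witness[of _ t t]) (auto simp: t_def split: if_splits)
  ultimately show ?thesis by (simp add: sum_negf)
qed

definition small_sets :: "nat \<Rightarrow> nat set set" where
  "small_sets n = {U. U \<subseteq> {..n} \<and> U \<noteq> {} \<and> card U \<le> 3}"

lemma finite_small_sets: "finite (small_sets n)"
  by (rule finite_subset[of _ "Pow {..n}"]) (auto simp: small_sets_def)

lemma triple_in_small_sets: "{i, j, k} \<subseteq> {..n} \<Longrightarrow> {i, j, k} \<in> small_sets n"
  by (auto simp: small_sets_def card_insert_if)

lemma small_sets_triple:
  assumes "U \<in> small_sets n"
  obtains i j k where "U = {i, j, k}"
proof -
  have U: "finite U" "U \<noteq> {}" "card U \<le> 3"
    using assms finite_subset[of U "{..n}"] by (auto simp: small_sets_def)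
  then have "card U = 1 \<or> card U = 2 \<or> card U = 3"
    by (auto simp: card_eq_0_iff le_Suc_eq numeral_3_eq_3 numeral_2_eq_2)
  then show ?thesis
    using that by (auto simp: card_1_singleton_iff card_2_iff card_3_iff)
qed

lemma card_small_sets: "card (small_sets n) \<le> (n + 1) ^ 3"
proof -
  have "small_sets n \<subseteq> (\<lambda>(i, j, k). {i, j, k}) ` ({..n} \<times> {..n} \<times> {..n})"
  proof
    fix U assume U: "U \<in> small_sets n"
    then obtain i j k where "U = {i, j, k}" using small_sets_triple by blast
    then show "U \<in> (\<lambda>(i, j, k). {i, j, k}) ` ({..n} \<times> {..n} \<times> {..n})"
      using U by (intro image_eqI[of _ _ "(i, j, k)"]) (auto simp: small_sets_def)
  qed
  then have "card (small_sets n) \<le> card ({..n} \<times> {..n} \<times> {..n})"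
    by (rule surj_card_le[rotated]) auto
  then show ?thesis by (simp add: power3_eq_cube algebra_simps)
qed

text \<open>The sets \<open>{i, j, k}\<close> are exactly the members of
  \<open>small_sets n\<close>, so the equations for products of three squares form one square
  triangular system in the unknowns \<open>c U\<close>. Products of fewer squares follow because the
  rule \<open>Q\<close> and the integral obey the same recursion. There are at most
  \<open>(n + 1) ^ 3\<close> supports, each with at most \<open>2 ^ 3\<close> choices of
  signs.\<close>

lemma cubature_7:
  "\<exists>F w. is_cubature n 7 F w \<and> card F \<le> 8 * (n + 1) ^ 3"
proof -
  define E where "E is = (\<integral>x. sq_prod is x \<partial>sphere_measure n)" for "is"
  \<comment> \<open>The choice is well defined, because the moment depends only on the set of
    indices.\<close>
  define m where "m V = (SOME y. \<exists>i j k. V = {i, j, k} \<and> y = E [i, j, k])" for V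
  have m: "m {i, j, k} = E [i, j, k]" if "{i, j, k} \<subseteq> {..n}" for i j k
    unfolding m_def
  proof (rule some_equality)
    fix y assume "\<exists>i' j' k'. {i, j, k} = {i', j', k'} \<and> y = E [i', j', k']"
    then obtain i' j' k' where "{i, j, k} = {i', j', k'}" "y = E [i', j', k']"
      by blast
    then show "y = E [i, j, k]"
      using integral_sq_prod_set[OF _ that] unfolding E_def by metis
  qed blast
  have finU: "finite U" if "U \<in> small_sets n" for U
    using that finite_subset[of U "{..n}"] by (auto simp: small_sets_def)
  obtain c where c: "\<And>V. V \<in> small_sets n \<Longrightarrow> (\<Sum>U | U \<in> small_sets n \<and> V \<subseteq> U. c U) = m V"
    using triangular_system_superset[OF finite_small_sets finU, where m = m] by blast
  define T where "T = Sigma (small_sets n) Pow"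
  define g where "g = (\<lambda>(U, S). sign_point n U S)"
  \<comment> \<open>Each of the \<open>2 ^ card U\<close> signed points gives a product of three
    squares the value \<open>1 / card U ^ 3\<close> if its indices lie in \<open>U\<close>. This
    normalisation makes the total contribution of such a \<open>U\<close> equal to
    \<open>c U\<close>.\<close>
  define h where "h = (\<lambda>(U, S :: nat set). c U * card U ^ 3 / 2 ^ card U)"
  define Q where "Q f = (\<Sum>t\<in>T. h t * f (g t))" for f :: "(nat \<Rightarrow> real) \<Rightarrow> real"
  have finT: "finite T"
    unfolding T_def using finite_small_sets finU by auto
  have gT: "g t \<in> unit_sphere n" if "t \<in> T" for t
    using that by (auto simp: T_def g_def small_sets_def intro: sign_point_in_sphere)
  have Q: "Q f = (\<Sum>U\<in>small_sets n. c U * card U ^ 3 / 2 ^ card U * (\<Sum>S\<in>Pow U. f (sign_point n U S)))" for f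
    unfolding Q_def T_def g_def h_def sum_distrib_left
    using finite_small_sets finU by (subst sum.Sigma) (simp_all add: case_prod_unfold)
  have Q_Cons: "Q (sq_prod is) = (\<Sum>i\<le>n. Q (sq_prod (i # is)))" for "is"
  proof -
    have *: "(\<Sum>i\<le>n. h t * sq_prod (i # is) (g t)) = h t * sq_prod is (g t) * (\<Sum>i\<le>n. (g t i)\<^sup>2)" for t
      by (simp only: sq_prod_simps sum_distrib_left mult.assoc mult.commute mult.left_commute)
    have "(\<Sum>i\<le>n. Q (sq_prod (i # is))) = (\<Sum>t\<in>T. \<Sum>i\<le>n. h t * sq_prod (i # is) (g t))"
      unfolding Q_def by (rule sum.swap)
    also have "\<dots> = (\<Sum>t\<in>T. h t * sq_prod is (g t) * (\<Sum>i\<le>n. (g t i)\<^sup>2))"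
      by (simp only: *)
    also have "\<dots> = Q (sq_prod is)"
      unfolding Q_def using gT by (intro sum.cong refl) (simp add: unit_sphere_sum_squares)
    finally show ?thesis by simp
  qed
  have Q3: "Q (sq_prod [i, j, k]) = E [i, j, k]" if ijk: "{i, j, k} \<subseteq> {..n}" for i j k
  proof -
    have "Q (sq_prod [i, j, k]) = (\<Sum>U\<in>small_sets n. if {i, j, k} \<subseteq> U then c U else 0)"
      unfolding Q
    proof (intro sum.cong refl)
      fix U assume U: "U \<in> small_sets n"
      then have U': "U \<subseteq> {..n}" "card U > 0"
        using finU[OF U] by (auto simp: small_sets_def card_gt_0_iff)
      have "(\<Sum>S\<in>Pow U. sq_prod [i, j, k] (sign_point n U S))
          = (\<Sum>S\<in>Pow U. if {i, j, k} \<subseteq> U then 1 / card U ^ 3 else 0)"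
        using ijk by (intro sum.cong refl) (auto simp: sign_point_sq[OF U'(1)] power3_eq_cube)
      also have "\<dots> = (if {i, j, k} \<subseteq> U then 2 ^ card U / card U ^ 3 else 0)"
        using finU[OF U] by (simp add: card_Pow)
      finally show "c U * card U ^ 3 / 2 ^ card U * (\<Sum>S\<in>Pow U. sq_prod [i, j, k] (sign_point n U S))
          = (if {i, j, k} \<subseteq> U then c U else 0)"
        using U' by simp
    qed
    also have "\<dots> = (\<Sum>U | U \<in> small_sets n \<and> {i, j, k} \<subseteq> U. c U)"
      using finite_small_sets by (subst sum.inter_filter[symmetric]) auto
    also have "\<dots> = E [i, j, k]"
      using c[OF triple_in_small_sets[OF ijk]] m[OF ijk] by simp
    finally show ?thesis .
  qed
  \<comment> \<open>Descending induction on the length of the list, starting from length 3: the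
    claim for all one-element extensions gives the claim for the list by summation.\<close>
  have Q_le3: "Q (sq_prod is) = E is" if "set is \<subseteq> {..n}" "length is \<le> 3" for "is"
    using that
  proof (induction "3 - length is" arbitrary: "is")
    case 0
    then have "length is = 3" by simp
    then obtain i j k where ijk: "is = [i, j, k]"
      by (auto simp: numeral_3_eq_3 length_Suc_conv)
    then have "{i, j, k} \<subseteq> {..n}" using 0 by auto
    then show ?case unfolding ijk by (rule Q3)
  next
    case (Suc d)
    have "Q (sq_prod (i # is)) = E (i # is)" if "i \<le> n" for i
      using Suc that by (intro Suc.hyps(1)) auto
    then have "(\<Sum>i\<le>n. Q (sq_prod (i # is))) = (\<Sum>i\<le>n. E (i # is))"
      by (intro sum.cong refl) blast
    then show ?case
      unfolding E_def integral_sq_prod_Cons[OF Suc.prems(1)] Q_Cons[of "is"] .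
  qed
  have "(\<integral>x. monomial n \<alpha> x \<partial>sphere_measure n) = Q (monomial n \<alpha>)" if \<alpha>: "\<alpha> \<in> multi_indices n 7" for \<alpha>
  proof (cases "\<forall>i\<le>n. even (\<alpha> i)")
    case True
    then have "even (\<Sum>i\<le>n. \<alpha> i)" by (intro dvd_sum) auto
    then obtain d where d: "(\<Sum>i\<le>n. \<alpha> i) = 2 * d" by auto
    then have "d \<le> 3" using \<alpha> by (simp add: multi_indices_def)
    obtain "is" where "is": "length is = d" "set is \<subseteq> {..n}" "\<And>x. monomial n \<alpha> x = sq_prod is x"
      using even_monomial_eq_sq_prod[of n \<alpha> d] True d by blast
    then show ?thesis
      using Q_le3[of "is"] \<open>d \<le> 3\<close> by (simp add: E_def)
  next
    case False
    then obtain i where i: "i \<le> n" "odd (\<alpha> i)" by blast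
    have "Q (monomial n \<alpha>) = 0"
      unfolding Q using sum_sign_point_odd_monomial[of _ n i \<alpha>] i
      by (intro sum.neutral) (auto simp: small_sets_def)
    then show ?thesis using integral_odd_monomial[of i n \<alpha>] i by simp
  qed
  then have "is_cubature n 7 (g ` T) (\<lambda>p. \<Sum>t\<in>{t\<in>T. g t = p}. h t)"
    using finT gT by (intro is_cubature_family) (auto simp: Q_def)
  moreover have "card (g ` T) \<le> 8 * (n + 1) ^ 3"
  proof -
    have "card (g ` T) \<le> card T" using finT by (rule card_image_le)
    also have "\<dots> = (\<Sum>U\<in>small_sets n. 2 ^ card U)"
      unfolding T_def using finite_small_sets finU by (subst card_SigmaI) (auto simp: card_Pow)
    also have "\<dots> \<le> (\<Sum>U\<in>small_sets n. 2 ^ 3)"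
      by (intro sum_mono power_increasing) (auto simp: small_sets_def)
    also have "\<dots> \<le> 8 * (n + 1) ^ 3"
      using card_small_sets[of n] by simp
    finally show ?thesis .
  qed
  ultimately show ?thesis by blast
qed

text \<open>The formulas of \<open>cubature_7\<close> have only cubically many points, fewer than
  required for large \<open>n\<close>. Padding brings them to a count with leading term
  \<open>4 * n ^ 4\<close>.\<close>

lemma cubature_7_asymptotic:
  "\<exists>N :: nat \<Rightarrow> nat.
      (\<forall>n. \<exists>F w. is_cubature n 7 F w \<and> card F = N n) \<and>
      (\<exists>C :: real. \<forall>n\<ge>1. real (N n) \<le> C * real n ^ 4) \<and>
      (\<lambda>n. real (N n)) \<sim>[at_top] (\<lambda>n. 4 * real n ^ 4)"
proof -
  obtain F0 w0 where F0: "is_cubature 0 7 F0 w0"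
    using cubature_7[of 0] by blast
  define N where "N n = (if n = 0 then card F0 else 4 * n ^ 4 + 8 * (n + 1) ^ 3)" for n
  have "\<exists>F w. is_cubature n 7 F w \<and> card F = N n" for n
  proof (cases "n = 0")
    case True
    then show ?thesis using F0 by (auto simp: N_def)
  next
    case False
    obtain F w where "is_cubature n 7 F w" "card F \<le> 8 * (n + 1) ^ 3"
      using cubature_7 by blast
    then show ?thesis
      using False by (intro is_cubature_pad) (auto simp: N_def)
  qed
  \<comment> \<open>The constant is \<open>4 + 8 * 8\<close>, from
    \<open>n + 1 \<le> 2 * n\<close>.\<close>
  moreover have "real (N n) \<le> 68 * real n ^ 4" if "n \<ge> 1" for n
  proof -
    have "(n + 1) ^ 3 \<le> (2 * n) ^ 3" using that by (intro power_mono) auto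
    also have "\<dots> = 8 * n ^ 3" by (simp add: power_mult_distrib)
    also have "\<dots> \<le> 8 * n ^ 4" using that by (simp add: power_increasing)
    finally have "N n \<le> 68 * n ^ 4" using that by (simp add: N_def)
    then have "real (N n) \<le> real (68 * n ^ 4)" by (rule of_nat_mono)
    then show ?thesis by simp
  qed
  moreover have "(\<lambda>n. real (N n)) \<sim>[at_top] (\<lambda>n. 4 * real n ^ 4)"
  proof -
    have "eventually (\<lambda>n. real (N n) = 4 * real n ^ 4 + 8 * (real n + 1) ^ 3) at_top"
      using eventually_gt_at_top[of 0] by eventually_elim (simp add: N_def add.commute)
    then have "(\<lambda>n. real (N n)) \<sim>[at_top] (\<lambda>n. 4 * real n ^ 4 + 8 * (real n + 1) ^ 3)"
      by (rule asymp_equiv_refl_ev)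
    also have "(\<lambda>n. 4 * real n ^ 4 + 8 * (real n + 1) ^ 3) \<sim>[at_top] (\<lambda>n. 4 * real n ^ 4)"
      by real_asymp
    finally show ?thesis .
  qed
  ultimately show ?thesis by blast
qed

section \<open>Gauss quadrature\<close>

text \<open>The witness \<open>A\<close> consists of the roots of odd multiplicity in the open
  interval, that is, the sign changes of \<open>p\<close>. Multiplying by one further linear factor
  for each makes all multiplicities there even. The constant \<open>e\<close> fixes the
  sign.\<close>

lemma poly_sign_change_roots:
  fixes p :: "real poly"
  assumes "p \<noteq> 0"
  shows "\<exists>A e. finite A \<and> A \<subseteq> {0<..<1} \<and> (\<forall>a\<in>A. poly p a = 0) \<and> card A \<le> degree p \<and> e \<noteq> 0 \<and>
    (\<forall>t\<in>{0..1}. 0 \<le> e * poly (p * (\<Prod>a\<in>A. [:-a, 1:])) t)"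
  using assms
proof (induction "degree p" arbitrary: p rule: less_induct)
  case less
  show ?case
  proof (cases "\<exists>a\<in>{0<..<1}. poly p a = 0")
    case True
    then obtain a where a: "a \<in> {0<..<1}" "poly p a = 0" by auto
    then obtain p' where p': "p = [:-a, 1:] * p'"
      by (metis dvd_def poly_eq_0_iff_dvd)
    with less.prems have "p' \<noteq> 0" by auto
    have deg: "degree p = Suc (degree p')"
      unfolding p' using \<open>p' \<noteq> 0\<close> by (subst degree_mult_eq) auto
    from less.hyps[of p'] deg \<open>p' \<noteq> 0\<close>
    obtain A e where A: "finite A" "A \<subseteq> {0<..<1}" "\<forall>a\<in>A. poly p' a = 0" "card A \<le> degree p'" "e \<noteq> 0"
      "\<forall>t\<in>{0..1}. 0 \<le> e * poly (p' * (\<Prod>a\<in>A. [:-a, 1:])) t"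
      by auto
    show ?thesis
    \<comment> \<open>Restoring the factor with root \<open>a\<close> changes the parity of its
      multiplicity, so \<open>a\<close> leaves \<open>A\<close> if it was there and joins it
      otherwise.\<close>
    proof (cases "a \<in> A")
      case True
      have "p * (\<Prod>a\<in>A - {a}. [:-a, 1:]) = p' * (\<Prod>a\<in>A. [:-a, 1:])"
        unfolding p' using True A by (subst (2) prod.remove[of _ a]) (auto simp: algebra_simps)
      then show ?thesis
        using A deg by (intro exI[of _ "A - {a}"] exI[of _ e]) (auto simp: p' card_Diff_singleton_if)
    next
      case False
      have *: "p * (\<Prod>a\<in>insert a A. [:-a, 1:]) = [:-a, 1:]\<^sup>2 * (p' * (\<Prod>a\<in>A. [:-a, 1:]))"
        unfolding p' by (simp only: prod.insert[OF A(1) False] power2_eq_square mult_ac)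
      have "0 \<le> e * poly ([:-a, 1:]\<^sup>2 * (p' * (\<Prod>a\<in>A. [:-a, 1:]))) t" if "t \<in> {0..1}" for t
      proof -
        have "0 \<le> (poly [:-a, 1:] t)\<^sup>2 * (e * poly (p' * (\<Prod>a\<in>A. [:-a, 1:])) t)"
          using A(6) that by (intro mult_nonneg_nonneg[of "_\<^sup>2"] zero_le_power2) blast
        then show ?thesis
          by (simp only: poly_mult poly_power mult_ac)
      qed
      then show ?thesis
        using A deg a False *
        by (intro exI[of _ "insert a A"] exI[of _ e]) (auto simp: p')
    qed
  next
    case False
    \<comment> \<open>There is no root in the open interval, so by the intermediate value theorem
      \<open>p\<close> keeps the sign it has at \<open>1/2\<close>. The endpoints follow by taking
      the closure.\<close>
    define e where "e = poly p (1/2)"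
    have e: "e \<noteq> 0" using False by (auto simp: e_def)
    have pos: "0 < e * poly p t" if t: "t \<in> {0<..<1}" for t
    proof (rule ccontr)
      assume "\<not> ?thesis"
      then have "e * poly p t < 0"
        using False t e by (metis linorder_neqE_linordered_idom mult_eq_0_iff)
      moreover have "0 < e * poly p (1/2)" using e by (auto simp: e_def zero_less_mult_iff)
      ultimately have neg: "poly (smult e p) t * poly (smult e p) (1/2) < 0"
        by (simp add: mult_neg_pos)
      then have "t \<noteq> 1/2"
        by (metis not_square_less_zero)
      then obtain u where "u \<in> {0<..<1}" "poly (smult e p) u = 0"
      proof (cases "t < 1/2")
        case True
        from poly_IVT[OF this neg] obtain u where "u>t" "u<1/2" "poly (smult e p) u = 0" by blast
        with that[of u] t show ?thesis by auto
      next
        case False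
        with \<open>t \<noteq> 1/2\<close> have "1/2 < t" by simp
        have "poly (smult e p) (1/2) * poly (smult e p) t < 0"
          using neg by (simp only: mult.commute)
        from poly_IVT[OF \<open>1/2 < t\<close> this] obtain u where "u>1/2" "u<t" "poly (smult e p) u = 0"
          by blast
        with that[of u] t show ?thesis by auto
      qed
      with False e show False by simp
    qed
    have "0 \<le> e * poly p t" if "t \<in> {0..1}" for t
    proof -
      have "closed {t. 0 \<le> e * poly p t}"
        by (intro closed_Collect_le continuous_intros)
      moreover have "{0<..<1} \<subseteq> {t. 0 \<le> e * poly p t}"
        using pos by fastforce
      ultimately have "closure {0<..<1} \<subseteq> {t. 0 \<le> e * poly p t}"
        by (rule closure_minimal[rotated])
      then show ?thesis
        using that by auto
    qed
    then show ?thesis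
      using e by (intro exI[of _ "{}"] exI[of _ e]) auto
  qed
qed

text \<open>Models integration against a measure on [0, 1] that is not concentrated on finitely many
  points. Strictness in \<open>L_pos\<close> makes \<open>L (w * p * q)\<close> a definite inner
  product for every nonzero weight \<open>w\<close> that is nonnegative on [0, 1].\<close>

locale pos_functional =
  fixes L :: "real poly \<Rightarrow> real"
  assumes L_add: "L (p + q) = L p + L q"
    and L_smult: "L (smult c p) = c * L p"
    and L_pos: "p \<noteq> 0 \<Longrightarrow> (\<And>t. t \<in> {0..1} \<Longrightarrow> 0 \<le> poly p t) \<Longrightarrow> 0 < L p"
begin

lemma L_0: "L 0 = 0"
  using L_smult[of 0 0] by simp

lemma L_sum: "finite A \<Longrightarrow> L (\<Sum>a\<in>A. f a) = (\<Sum>a\<in>A. L (f a))"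
  by (induction A rule: finite_induct) (auto simp: L_0 L_add)

lemma L_diff: "L (p - q) = L p - L q"
  using L_add[of "p - q" q] by simp

text \<open>As \<open>degree 0 = 0\<close>, the disjunct \<open>q = 0\<close> makes the range of
  \<open>q\<close> the space of dimension \<open>m\<close> also when \<open>m = 0\<close>.\<close>

definition orth :: "real poly \<Rightarrow> nat \<Rightarrow> real poly \<Rightarrow> bool" where
  "orth w m p \<longleftrightarrow> (\<forall>q. (q = 0 \<or> degree q < m) \<longrightarrow> L (w * p * q) = 0)"

text \<open>Gram-Schmidt. The induction hypothesis is used twice: for \<open>monom 1 m\<close> it
  yields the monic orthogonal polynomial \<open>e\<close> of degree \<open>m\<close>, and for
  \<open>f\<close> the projection \<open>g1\<close> to lower degree, to which the component along
  \<open>e\<close> is added.\<close>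

lemma orth_projection_exists:
  assumes w: "w \<noteq> 0" "\<And>t. t \<in> {0..1} \<Longrightarrow> 0 \<le> poly w t"
  shows "\<exists>g. (g = 0 \<or> degree g < m) \<and> orth w m (f - g)"
proof (induction m arbitrary: f)
  case 0
  then show ?case by (auto simp: orth_def L_0)
next
  case (Suc m)
  obtain g0 where g0: "g0 = 0 \<or> degree g0 < m" "orth w m (monom 1 m - g0)"
    using Suc by blast
  define e where "e = monom 1 m - g0"
  have e: "degree e = m" "coeff e m = 1"
  proof -
    have c: "coeff g0 m = 0" using g0 by (auto simp: coeff_eq_0)
    then show "coeff e m = 1" by (simp add: e_def)
    have "degree e \<le> m" unfolding e_def using g0
      by (intro degree_diff_le) (auto simp: degree_monom_eq)
    with \<open>coeff e m = 1\<close> show "degree e = m"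
      by (metis le_degree le_antisym zero_neq_one)
  qed
  have "e \<noteq> 0" using e by auto
  have pos: "0 < L (w * e * e)"
    using w \<open>e \<noteq> 0\<close> by (intro L_pos) (auto simp: mult.assoc)
  obtain g1 where g1: "g1 = 0 \<or> degree g1 < m" "orth w m (f - g1)"
    using Suc by blast
  \<comment> \<open>The Fourier coefficient of \<open>f\<close> along \<open>e\<close>. Replacing
    \<open>f\<close> by \<open>f - g1\<close> would not change it, since \<open>e\<close> is
    orthogonal to \<open>g1\<close>.\<close>
  define c where "c = L (w * f * e) / L (w * e * e)"
  have orthe: "L (w * e * q) = 0" if "q = 0 \<or> degree q < m" for q
    using g0(2) that by (auto simp: orth_def e_def)
  have "orth w (Suc m) (f - (g1 + smult c e))"
    unfolding orth_def
  proof (intro allI impI)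
    fix q :: "real poly" assume q: "q = 0 \<or> degree q < Suc m"
    \<comment> \<open>As \<open>e\<close> is monic of degree \<open>m\<close>, subtracting
      \<open>smult b e\<close> lowers the test polynomial to degree below \<open>m\<close>, or to
      0.\<close>
    define b where "b = coeff q m"
    define q' where "q' = q - smult b e"
    have "coeff q' m = 0" "degree q' \<le> m"
      using q e by (auto simp: q'_def b_def intro!: degree_diff_le)
    then have q': "q' = 0 \<or> degree q' < m"
      by (metis le_neq_implies_less leading_coeff_0_iff)
    have qq: "q = q' + smult b e" by (simp add: q'_def)
    have 1: "L (w * (f - g1) * q') = 0"
      using g1(2) q' by (auto simp: orth_def)
    have 2: "L (w * g1 * e) = 0"
      using orthe[OF g1(1)] by (simp add: mult_ac)
    have "w * (f - (g1 + smult c e)) * q = w * (f - g1) * q' + smult b (w * f * e) - smult b (w * g1 * e)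
        - smult c (w * e * q') - smult (b * c) (w * e * e)"
      unfolding qq by (simp add: algebra_simps smult_diff_right smult_add_right)
    then have "L (w * (f - (g1 + smult c e)) * q) = b * L (w * f * e) - b * c * L (w * e * e)"
      using 1 2 orthe[OF q'] by (simp add: L_add L_diff L_smult)
    also have "\<dots> = 0" using pos by (simp add: c_def)
    finally show "L (w * (f - (g1 + smult c e)) * q) = 0" .
  qed
  moreover have "degree (g1 + smult c e) < Suc m"
    using g1(1) e by (auto intro!: le_imp_less_Suc degree_add_le)
  ultimately show ?case by blast
qed

text \<open>If \<open>p\<close> had fewer than \<open>m\<close> sign changes, the product of the
  linear factors at these would be orthogonal to \<open>p\<close>. But \<open>w * p\<close> times
  this product has constant sign on [0, 1] and is nonzero, contradicting strict positivity.\<close>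

lemma orth_poly_roots:
  assumes w: "w \<noteq> 0" "\<And>t. t \<in> {0..1} \<Longrightarrow> 0 \<le> poly w t"
  obtains p A where "degree p = m" "p \<noteq> 0" "orth w m p" "finite A" "A \<subseteq> {0<..<1}" "card A = m"
    "\<And>a. a \<in> A \<Longrightarrow> poly p a = 0"
proof -
  obtain g where g: "g = 0 \<or> degree g < m" "orth w m (monom 1 m - g)"
    using orth_projection_exists[OF w] by blast
  define p where "p = monom 1 m - g"
  have c: "coeff p m = 1"
    using g by (auto simp: p_def coeff_eq_0)
  have "degree p \<le> m" unfolding p_def using g
    by (intro degree_diff_le) (auto simp: degree_monom_eq)
  with c have deg: "degree p = m"
    by (metis le_degree le_antisym zero_neq_one)
  have "p \<noteq> 0" using c by auto
  from poly_sign_change_roots[OF this] obtain A e where A: "finite A" "A \<subseteq> {0<..<1}" "\<forall>a\<in>A. poly p a = 0"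
    "card A \<le> degree p" "e \<noteq> 0" "\<forall>t\<in>{0..1}. 0 \<le> e * poly (p * (\<Prod>a\<in>A. [:-a, 1:])) t"
    by auto
  have "card A = m"
  proof (rule ccontr)
    assume "card A \<noteq> m"
    then have "card A < m" using A deg by simp
    moreover have "degree (\<Prod>a\<in>A. [:-a, 1:]) = card A"
      by (subst degree_prod_eq_sum_degree) auto
    ultimately have "L (w * p * (\<Prod>a\<in>A. [:-a, 1:])) = 0"
      using g(2) by (auto simp: orth_def p_def)
    then have "L (smult e (w * p * (\<Prod>a\<in>A. [:-a, 1:]))) = 0"
      by (simp add: L_smult)
    moreover have "0 < L (smult e (w * p * (\<Prod>a\<in>A. [:-a, 1:])))"
    proof (rule L_pos)
      show "smult e (w * p * (\<Prod>a\<in>A. [:-a, 1:])) \<noteq> 0"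
        using w \<open>p \<noteq> 0\<close> A by auto
      fix t :: real assume t: "t \<in> {0..1}"
      have "0 \<le> poly w t * (e * poly (p * (\<Prod>a\<in>A. [:-a, 1:])) t)"
        using A(6) w(2) t by (intro mult_nonneg_nonneg[of "poly w t"]) (blast+)
      then show "0 \<le> poly (smult e (w * p * (\<Prod>a\<in>A. [:-a, 1:]))) t"
        by (simp only: poly_mult poly_smult mult_ac)
    qed
    ultimately show False by simp
  qed
  with that[OF deg \<open>p \<noteq> 0\<close>] g(2) A show ?thesis
    by (auto simp: p_def)
qed

text \<open>The weights are the values of \<open>L\<close> on the Lagrange basis polynomials
  \<open>lagn a\<close> of the nodes.\<close>

lemma interpolatory_quadrature:
  assumes "finite A"
  shows "\<exists>W. \<forall>f. degree f < card A \<longrightarrow> L f = (\<Sum>a\<in>A. W a * poly f a)"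
proof -
  define lag where "lag a = (\<Prod>b\<in>A - {a}. [:-b, 1:])" for a
  define lagn where "lagn a = smult (1 / poly (lag a) a) (lag a)" for a
  have nz: "poly (lag a) a \<noteq> 0" for a
    using assms by (auto simp: lag_def poly_prod)
  have val: "poly (lagn a) b = (if a = b then 1 else 0)" if "a \<in> A" "b \<in> A" for a b
    using nz[of a] that assms by (auto simp: lagn_def lag_def poly_prod)
  have deg: "degree (lagn a) < card A" if "a \<in> A" for a
  proof -
    have "degree (lag a) = card A - 1"
      using that assms unfolding lag_def by (subst degree_prod_eq_sum_degree) auto
    moreover have "card A > 0" using that assms by (auto simp: card_gt_0_iff)
    ultimately show ?thesis by (auto simp: lagn_def)
  qed
  have "L f = (\<Sum>a\<in>A. L (lagn a) * poly f a)" if f: "degree f < card A" for f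
  proof -
    define h where "h = (\<Sum>a\<in>A. smult (poly f a) (lagn a))"
    have eq: "poly f a = poly h a" if "a \<in> A" for a
      using that assms by (simp add: h_def poly_sum val if_distrib cong: if_cong)
    have "degree h < card A"
      unfolding h_def using deg f assms by (intro degree_sum_less) auto
    then have "f = h"
      using f eq poly_eqI_degree[of A f h] by auto
    moreover have "L h = (\<Sum>a\<in>A. L (lagn a) * poly f a)"
      using assms by (simp add: h_def L_sum L_smult mult.commute)
    ultimately show ?thesis by simp
  qed
  then show ?thesis by (intro exI[of _ "\<lambda>a. L (lagn a)"]) auto
qed

text \<open>Gauss quadrature with the zeros \<open>E\<close> of \<open>w\<close> as prescribed nodes.\<close>

lemma gauss_quadrature:
  assumes w: "w \<noteq> 0" "\<And>t. t \<in> {0..1} \<Longrightarrow> 0 \<le> poly w t"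
    and E: "finite E" "\<And>a. a \<in> E \<Longrightarrow> poly w a = 0" "card E = degree w" "E \<inter> {0<..<1} = {}"
  shows "\<exists>A W. finite A \<and> A \<subseteq> {0<..<1} \<and> card A = m \<and>
    (\<forall>f. degree f < degree w + 2 * m \<longrightarrow> L f = (\<Sum>a\<in>A \<union> E. W a * poly f a))"
proof -
  obtain p A where p: "degree p = m" "p \<noteq> 0" "orth w m p" "finite A" "A \<subseteq> {0<..<1}" "card A = m"
    "\<And>a. a \<in> A \<Longrightarrow> poly p a = 0"
    using orth_poly_roots[OF w] by blast
  have card: "card (A \<union> E) = degree w + m"
    using p E by (subst card_Un_disjoint) auto
  obtain W where W: "\<And>f. degree f < card (A \<union> E) \<Longrightarrow> L f = (\<Sum>a\<in>A \<union> E. W a * poly f a)"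
    using interpolatory_quadrature[of "A \<union> E"] p E by auto
  have degwp: "degree (w * p) = degree w + m"
    using w p by (simp add: degree_mult_eq)
  have "L f = (\<Sum>a\<in>A \<union> E. W a * poly f a)" if f: "degree f < degree w + 2 * m" for f
  proof (cases "degree w + m = 0")
    case True
    then show ?thesis using f by simp
  next
    case False
    \<comment> \<open>Division by the nodal polynomial \<open>w * p\<close>. The quotient has degree
      below \<open>m\<close> (or is 0), so orthogonality removes its contribution to
      \<open>L f\<close>. The remainder agrees with \<open>f\<close> at all nodes and is integrated
      exactly by interpolation.\<close>
    define q where "q = f div (w * p)"
    define r where "r = f mod (w * p)"
    have fqr: "f = w * p * q + r" by (simp add: q_def r_def)
    have wp: "w * p \<noteq> 0" using w p by simp
    have r: "degree r < degree w + m"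
      using degree_mod_less[OF wp, of f] degwp False by (auto simp: r_def)
    have q: "q = 0 \<or> degree q < m"
    proof (rule ccontr)
      assume "\<not> ?thesis"
      then have q: "q \<noteq> 0" "degree q \<ge> m" by auto
      then have "degree (w * p * q) = degree w + m + degree q"
        using wp degwp by (simp add: degree_mult_eq)
      moreover have "degree f = degree (w * p * q)"
        unfolding fqr using r calculation by (intro degree_add_eq_left) auto
      ultimately show False using f q by simp
    qed
    have "L f = L r"
      unfolding fqr using p(3)[unfolded orth_def, rule_format, OF q] by (simp add: L_add)
    also have "\<dots> = (\<Sum>a\<in>A \<union> E. W a * poly r a)"
      using W r card by simp
    also have "\<dots> = (\<Sum>a\<in>A \<union> E. W a * poly f a)"
      using p(7) E(2) by (intro sum.cong refl) (auto simp: fqr)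
    finally show ?thesis .
  qed
  then show ?thesis using p by blast
qed

text \<open>The weight polynomial is \<open>t\<close>, whose zero is the prescribed node 0.\<close>

lemma gauss_radau_quadrature:
  "\<exists>A W. finite A \<and> A \<subseteq> {0<..<1} \<and> card A = m \<and>
    (\<forall>f. degree f \<le> 2 * m \<longrightarrow> L f = (\<Sum>a\<in>insert 0 A. W a * poly f a))"
proof -
  have "\<exists>A W. finite A \<and> A \<subseteq> {0<..<1} \<and> card A = m \<and>
    (\<forall>f. degree f < degree [:0, 1 :: real:] + 2 * m \<longrightarrow> L f = (\<Sum>a\<in>A \<union> {0}. W a * poly f a))"
    by (rule gauss_quadrature) auto
  then show ?thesis by (simp add: less_Suc_eq_le)
qed

text \<open>The weight polynomial \<open>[:0, 1, -1:]\<close> is \<open>t * (1 - t)\<close>, which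
  prescribes both endpoints as nodes.\<close>

lemma gauss_lobatto_quadrature:
  "\<exists>A W. finite A \<and> A \<subseteq> {0<..<1} \<and> card A = m \<and>
    (\<forall>f. degree f \<le> 2 * m + 1 \<longrightarrow> L f = (\<Sum>a\<in>insert 0 (insert 1 A). W a * poly f a))"
proof -
  have "\<exists>A W. finite A \<and> A \<subseteq> {0<..<1} \<and> card A = m \<and>
    (\<forall>f. degree f < degree [:0, 1, -1 :: real:] + 2 * m \<longrightarrow> L f = (\<Sum>a\<in>A \<union> {0, 1}. W a * poly f a))"
  proof (rule gauss_quadrature)
    fix t :: real assume "t \<in> {0..1}"
    then have "0 \<le> t * (1 - t)" by simp
    then show "0 \<le> poly [:0, 1, -1:] t" by (simp add: algebra_simps)
  qed auto
  moreover have "A \<union> {0, 1} = insert 0 (insert (1::real) A)" for A by auto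
  ultimately show ?thesis by (simp add: less_Suc_eq_le numeral_2_eq_2)
qed

end

section \<open>The three-dimensional sphere\<close>

lemma emeasure_PiM_finite_sections:
  assumes i: "i \<le> n" and A: "A \<in> sets (lborel_PiM n)" and fin: "\<And>x. finite {y. x(i := y) \<in> A}"
  shows "emeasure (lborel_PiM n) A = 0"
proof -
  have "emeasure (lborel_PiM n) A = (\<integral>\<^sup>+x. indicator A x \<partial>lborel_PiM n)"
    using A by simp
  also have "\<dots> = (\<integral>\<^sup>+x. (\<integral>\<^sup>+y. indicator A (x(i := y)) \<partial>lborel) \<partial>(\<Pi>\<^sub>M i\<in>{..n} - {i}. lborel))"
    using A by (intro nn_integral_PiM_section[OF i]) simp
  also have "\<dots> = (\<integral>\<^sup>+x. 0 \<partial>(\<Pi>\<^sub>M i\<in>{..n} - {i}. lborel :: real measure))"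
  proof (rule nn_integral_cong)
    fix x :: "nat \<Rightarrow> real"
    have "(\<integral>\<^sup>+y. indicator A (x(i := y)) \<partial>lborel) = (\<integral>\<^sup>+y. indicator {y. x(i := y) \<in> A} y \<partial>lborel)"
      by (intro nn_integral_cong) (simp add: indicator_def)
    also have "\<dots> = emeasure lborel {y. x(i := y) \<in> A}"
      using finite_imp_closed[OF fin] by (intro nn_integral_indicator) auto
    also have "\<dots> = 0"
      by (rule emeasure_lborel_countable[OF countable_finite[OF fin]])
    finally show "(\<integral>\<^sup>+y. indicator A (x(i := y)) \<partial>lborel) = 0" .
  qed
  finally show ?thesis by simp
qed

lemma finite_real_square_eq: "finite {y :: real. y\<^sup>2 = k}"
  by (rule finite_subset[of _ "{sqrt k, - sqrt k}"]) (auto simp: real_sqrt_abs abs_if)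

lemma sum_atMost_3: "(\<Sum>i\<le>(3::nat). f i) = f 0 + f 1 + f 2 + f 3"
  by (simp add: numeral_3_eq_3 numeral_2_eq_2)

lemma prod_atMost_3: "(\<Prod>i\<le>(3::nat). f i) = f 0 * f 1 * f 2 * (f 3 :: 'a :: comm_monoid_mult)"
  by (simp add: numeral_3_eq_3 numeral_2_eq_2)

definition lat :: "(nat \<Rightarrow> real) \<Rightarrow> real" where
  "lat x = (x 0)\<^sup>2 + (x 1)\<^sup>2"

lemma lat_measurable [measurable]: "lat \<in> borel_measurable (lborel_PiM 3)"
  unfolding lat_def[abs_def] by simp

lemma unit_sphere_3: "x \<in> unit_sphere 3 \<Longrightarrow> (x 0)\<^sup>2 + (x 1)\<^sup>2 + (x 2)\<^sup>2 + (x 3)\<^sup>2 = 1"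
  using unit_sphere_sum_squares[of x 3] by (simp add: sum_atMost_3)

lemma lat_bounds: "x \<in> unit_sphere 3 \<Longrightarrow> lat x \<in> {0..1}"
  using unit_sphere_3[of x] by (simp add: lat_def) (smt (verit) zero_le_power2)

text \<open>The cone over a level set lies in the zero set \<open>N\<close> of the quadratic form
  \<open>lat x - c * (\<Sum>i\<le>3. (x i)\<^sup>2)\<close>. The coefficient of the square of
  \<open>x 0\<close> is \<open>1 - c\<close>, so lines in this direction meet \<open>N\<close> in
  finitely many points unless \<open>c = 1\<close>; in that case the direction \<open>x 2\<close>
  serves.\<close>

lemma AE_lat_neq: "AE x in sphere_measure 3. lat x \<noteq> c"
proof -
  let ?M = "lborel_PiM 3"
  define A where "A = {x \<in> space ?M. lat x = c}"
  define N where "N = {x \<in> space ?M. lat x = c * (\<Sum>i\<le>3. (x i)\<^sup>2)}"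
  have A: "A \<in> sets ?M" unfolding A_def by measurable
  have N: "N \<in> sets ?M" unfolding N_def by measurable
  have sub: "{x \<in> punctured_ball 3. radial_proj 3 x \<in> A} \<subseteq> N"
  proof
    fix x assume x: "x \<in> {x \<in> punctured_ball 3. radial_proj 3 x \<in> A}"
    then have pos: "0 < eucl_norm 3 x" and "lat (radial_proj 3 x) = c"
      by (auto simp: punctured_ball_def A_def)
    moreover have "lat (radial_proj 3 x) = lat x / (eucl_norm 3 x)\<^sup>2"
      by (simp add: lat_def radial_proj_def power_divide add_divide_distrib)
    ultimately have "lat x = c * (eucl_norm 3 x)\<^sup>2"
      using pos by (simp add: field_simps)
    then show "x \<in> N"
      using x by (auto simp: N_def punctured_ball_def space_lborel_PiM eucl_norm_def sum_nonneg)
  qed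
  have "emeasure ?M N = 0"
  proof (cases "c = 1")
    case True
    have "finite {y. x(2 := y) \<in> N}" for x
    proof (rule finite_subset[OF _ finite_real_square_eq[of "- (x 3)\<^sup>2"]])
      show "{y. x(2 := y) \<in> N} \<subseteq> {y. y\<^sup>2 = - (x 3)\<^sup>2}"
        using True by (auto simp: N_def lat_def sum_atMost_3)
    qed
    then show ?thesis
      by (intro emeasure_PiM_finite_sections[OF _ N, of 2]) auto
  next
    case False
    have "finite {y. x(0 := y) \<in> N}" for x
    proof (rule finite_subset[OF _ finite_real_square_eq])
      show "{y. x(0 := y) \<in> N} \<subseteq> {y. y\<^sup>2 = (c * ((x 1)\<^sup>2 + (x 2)\<^sup>2 + (x 3)\<^sup>2) - (x 1)\<^sup>2) / (1 - c)}"
      proof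
        fix y assume "y \<in> {y. x(0 := y) \<in> N}"
        then have "y\<^sup>2 + (x 1)\<^sup>2 = c * (y\<^sup>2 + (x 1)\<^sup>2 + (x 2)\<^sup>2 + (x 3)\<^sup>2)"
          by (simp add: N_def lat_def sum_atMost_3)
        then have "y\<^sup>2 * (1 - c) = c * ((x 1)\<^sup>2 + (x 2)\<^sup>2 + (x 3)\<^sup>2) - (x 1)\<^sup>2"
          by (simp add: algebra_simps)
        then show "y \<in> {y. y\<^sup>2 = (c * ((x 1)\<^sup>2 + (x 2)\<^sup>2 + (x 3)\<^sup>2) - (x 1)\<^sup>2) / (1 - c)}"
          using False by (simp add: eq_divide_eq)
      qed
    qed
    then show ?thesis
      by (intro emeasure_PiM_finite_sections[OF _ N, of 0]) auto
  qed
  then have "emeasure ?M {x \<in> punctured_ball 3. radial_proj 3 x \<in> A} = 0"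
    using emeasure_mono[OF sub N] by simp
  then have "emeasure (sphere_measure 3) (A \<inter> unit_sphere 3) = 0"
    using emeasure_sphere_measure[OF A] by simp
  then show ?thesis
  proof (intro AE_I[of _ _ "A \<inter> unit_sphere 3"])
    show "{x \<in> space (sphere_measure 3). \<not> lat x \<noteq> c} \<subseteq> A \<inter> unit_sphere 3"
      by (auto simp: space_sphere_measure A_def space_lborel_PiM unit_sphere_def)
    show "A \<inter> unit_sphere 3 \<in> sets (sphere_measure 3)"
      using A by (auto simp: sets_sphere_measure sets_restrict_space)
  qed
qed

definition lat_functional :: "real poly \<Rightarrow> real" where
  "lat_functional f = (\<integral>x. poly f (lat x) \<partial>sphere_measure 3)"

lemma integrable_poly_lat: "integrable (sphere_measure 3) (\<lambda>x. poly f (lat x))"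
proof -
  have cont: "continuous_on S (poly f)" for S
    by (intro continuous_intros)
  have "poly f \<in> borel_measurable borel"
    by (rule borel_measurable_continuous_onI[OF cont])
  then have meas: "(\<lambda>x. poly f (lat x)) \<in> borel_measurable (lborel_PiM 3)"
    by (rule measurable_compose[OF lat_measurable])
  have "bounded (poly f ` {0..1})"
    by (rule compact_imp_bounded[OF compact_continuous_image[OF cont compact_Icc]])
  then obtain K where "\<forall>t\<in>{0..1}. \<bar>poly f t\<bar> \<le> K"
    by (auto simp: bounded_iff)
  then show ?thesis
    using meas lat_bounds by (intro integrable_sphere_measure_bounded[where K = K]) blast+
qed

text \<open>For strict positivity: a nonnegative integrand with integral 0 vanishes almost
  everywhere, but a nonzero polynomial has finitely many roots, and \<open>lat\<close> takes each of
  them only on a null set.\<close>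

interpretation lat: pos_functional lat_functional
proof
  show "lat_functional (p + q) = lat_functional p + lat_functional q" for p q
    by (simp add: lat_functional_def Bochner_Integration.integral_add[OF integrable_poly_lat integrable_poly_lat])
  show "lat_functional (smult c p) = c * lat_functional p" for c p
    by (simp add: lat_functional_def)
  fix p :: "real poly" assume p: "p \<noteq> 0" "\<And>t. t \<in> {0..1} \<Longrightarrow> 0 \<le> poly p t"
  interpret prob_space "sphere_measure 3"
    by (rule prob_space_sphere_measure)
  have nonneg: "AE x in sphere_measure 3. 0 \<le> poly p (lat x)"
    using p(2) lat_bounds by (intro AE_I2) (auto simp: space_sphere_measure)
  have "lat_functional p \<noteq> 0"
  proof
    assume "lat_functional p = 0"
    then have "AE x in sphere_measure 3. poly p (lat x) = 0"
      using integral_nonneg_eq_0_iff_AE[OF integrable_poly_lat nonneg] by (simp add: lat_functional_def)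
    moreover have "AE x in sphere_measure 3. \<forall>c\<in>{c. poly p c = 0}. lat x \<noteq> c"
      using poly_roots_finite[OF p(1)] AE_lat_neq by (subst AE_finite_all) auto
    ultimately have "AE x in sphere_measure 3. False"
      by eventually_elim blast
    then show False by simp
  qed
  moreover have "0 \<le> lat_functional p"
    unfolding lat_functional_def using nonneg by (rule integral_nonneg_AE)
  ultimately show "0 < lat_functional p" by simp
qed

section \<open>Homogeneous polynomials of the plane in terms of \<open>z\<close> and
  \<open>cnj z\<close>\<close>

definition homogeneous :: "nat \<Rightarrow> (complex \<Rightarrow> complex) \<Rightarrow> bool" where
  "homogeneous m F \<longleftrightarrow> (\<exists>c. \<forall>z. F z = (\<Sum>j\<le>m. c j * (z ^ (m - j) * cnj z ^ j)))"

lemma homogeneous_add: "homogeneous m F \<Longrightarrow> homogeneous m G \<Longrightarrow> homogeneous m (\<lambda>z. F z + G z)"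
  unfolding homogeneous_def
proof (elim exE)
  fix c d assume "\<forall>z. F z = (\<Sum>j\<le>m. c j * (z ^ (m - j) * cnj z ^ j))" "\<forall>z. G z = (\<Sum>j\<le>m. d j * (z ^ (m - j) * cnj z ^ j))"
  then show "\<exists>c. \<forall>z. F z + G z = (\<Sum>j\<le>m. c j * (z ^ (m - j) * cnj z ^ j))"
    by (intro exI[of _ "\<lambda>j. c j + d j"]) (simp add: sum.distrib distrib_right)
qed

lemma homogeneous_scale: "homogeneous m F \<Longrightarrow> homogeneous m (\<lambda>z. b * F z)"
  unfolding homogeneous_def
proof (elim exE)
  fix c assume "\<forall>z. F z = (\<Sum>j\<le>m. c j * (z ^ (m - j) * cnj z ^ j))"
  then show "\<exists>c. \<forall>z. b * F z = (\<Sum>j\<le>m. c j * (z ^ (m - j) * cnj z ^ j))"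
    by (intro exI[of _ "\<lambda>j. b * c j"]) (simp add: sum_distrib_left mult.assoc)
qed

lemma homogeneous_mult_id:
  assumes "homogeneous m F"
  shows "homogeneous (Suc m) (\<lambda>z. z * F z)"
proof -
  obtain c where c: "\<And>z. F z = (\<Sum>j\<le>m. c j * (z ^ (m - j) * cnj z ^ j))"
    using assms by (auto simp: homogeneous_def)
  have "z * F z = (\<Sum>j\<le>Suc m. (if j \<le> m then c j else 0) * (z ^ (Suc m - j) * cnj z ^ j))" for z
  proof -
    have "(\<Sum>j\<le>Suc m. (if j \<le> m then c j else 0) * (z ^ (Suc m - j) * cnj z ^ j))
        = (\<Sum>j\<le>m. (if j \<le> m then c j else 0) * (z ^ (Suc m - j) * cnj z ^ j))"
      unfolding sum.atMost_Suc by simp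
    also have "\<dots> = z * F z"
      unfolding c sum_distrib_left
      by (intro sum.cong refl) (simp only: atMost_iff Suc_diff_le power_Suc if_True mult_ac)
    finally show ?thesis ..
  qed
  then show ?thesis
    unfolding homogeneous_def by (intro exI[of _ "\<lambda>j. if j \<le> m then c j else 0"] allI)
qed

lemma homogeneous_mult_cnj:
  assumes "homogeneous m F"
  shows "homogeneous (Suc m) (\<lambda>z. cnj z * F z)"
proof -
  obtain c where c: "\<And>z. F z = (\<Sum>j\<le>m. c j * (z ^ (m - j) * cnj z ^ j))"
    using assms by (auto simp: homogeneous_def)
  have "cnj z * F z = (\<Sum>j\<le>Suc m. (case j of 0 \<Rightarrow> 0 | Suc k \<Rightarrow> c k) * (z ^ (Suc m - j) * cnj z ^ j))" for z
    unfolding c sum_distrib_left by (subst sum.atMost_Suc_shift) (simp add: mult_ac)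
  then show ?thesis
    unfolding homogeneous_def by (intro exI[of _ "\<lambda>j. case j of 0 \<Rightarrow> 0 | Suc k \<Rightarrow> c k"] allI)
qed

text \<open>Induction on the exponents, with \<open>Re z = (z + cnj z) / 2\<close> and
  \<open>Im z = - (\<i> / 2) * (z - cnj z)\<close>.\<close>

lemma homogeneous_monomial: "homogeneous (a + b) (\<lambda>z. of_real (Re z ^ a * Im z ^ b))"
proof (induction a)
  case 0
  show ?case
  proof (induction b)
    case 0
    show ?case unfolding homogeneous_def by (intro exI[of _ "\<lambda>_. 1"]) simp
  next
    case (Suc b)
    let ?F = "\<lambda>z. of_real (Re z ^ 0 * Im z ^ b) :: complex"
    have "homogeneous (Suc (0 + b)) (\<lambda>z. - (\<i> / 2) * (z * ?F z) + \<i> / 2 * (cnj z * ?F z))"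
      using Suc by (intro homogeneous_add homogeneous_scale homogeneous_mult_id homogeneous_mult_cnj)
    also have "(\<lambda>z. - (\<i> / 2) * (z * ?F z) + \<i> / 2 * (cnj z * ?F z)) = (\<lambda>z. of_real (Re z ^ 0 * Im z ^ Suc b))"
    proof
      fix z
      have "- (\<i> / 2) * (z * ?F z) + \<i> / 2 * (cnj z * ?F z) = (- (\<i> / 2) * (z - cnj z)) * ?F z"
        by (simp only: minus_mult_left[symmetric] right_diff_distrib left_diff_distrib mult.assoc minus_diff_eq uminus_add_conv_diff diff_minus_eq_add)

      also have "- (\<i> / 2) * (z - cnj z) = of_real (Im z)"
        by (simp add: complex_eq_iff)
      finally show "- (\<i> / 2) * (z * ?F z) + \<i> / 2 * (cnj z * ?F z) = of_real (Re z ^ 0 * Im z ^ Suc b)"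
        by simp
    qed
    finally show ?case by simp
  qed
next
  case (Suc a)
  let ?F = "\<lambda>z. of_real (Re z ^ a * Im z ^ b) :: complex"
  have "homogeneous (Suc (a + b)) (\<lambda>z. 1 / 2 * (z * ?F z) + 1 / 2 * (cnj z * ?F z))"
    using Suc by (intro homogeneous_add homogeneous_scale homogeneous_mult_id homogeneous_mult_cnj)
  also have "(\<lambda>z. 1 / 2 * (z * ?F z) + 1 / 2 * (cnj z * ?F z)) = (\<lambda>z. of_real (Re z ^ Suc a * Im z ^ b))"
  proof
    fix z
    have "1 / 2 * (z * ?F z) + 1 / 2 * (cnj z * ?F z) = (1 / 2 * (z + cnj z)) * ?F z"
      by (simp add: algebra_simps)
    also have "1 / 2 * (z + cnj z) = of_real (Re z)"
      by (simp add: complex_eq_iff)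
    finally show "1 / 2 * (z * ?F z) + 1 / 2 * (cnj z * ?F z) = of_real (Re z ^ Suc a * Im z ^ b)"
      by simp
  qed
  finally show ?case by simp
qed

section \<open>Characters and averages over the finite torus group\<close>

lemma sum_cis_roots_of_unity:
  assumes "0 < N"
  shows "(\<Sum>a<N. cis (2 * pi * of_int k * real a / real N)) = (if int N dvd k then of_nat N else 0)"
proof -
  define z where "z = cis (2 * pi * of_int k / real N)"
  have z: "cis (2 * pi * of_int k * real a / real N) = z ^ a" for a
    by (simp only: z_def Complex.DeMoivre times_divide_eq_right mult_ac)
  have zN: "z ^ N = 1"
    using assms by (simp add: z_def Complex.DeMoivre cis_multiple_2pi)
  have z1: "z = 1 \<longleftrightarrow> int N dvd k"
  proof
    assume "z = 1"
    then obtain q where "2 * pi * of_int k / real N = of_int q * (2 * pi)"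
      unfolding z_def cis_eq_1_iff by blast
    then have "of_int k = (of_int (int N * q) :: real)"
      using assms by (simp add: field_simps)
    then have "k = int N * q" by (simp only: of_int_eq_iff)
    then show "int N dvd k" by simp
  next
    assume "int N dvd k"
    then obtain q where "k = int N * q" ..
    then have "2 * pi * of_int k / real N = of_int q * (2 * pi)"
      using assms by simp
    then show "z = 1" unfolding z_def cis_eq_1_iff by blast
  qed
  show ?thesis
  proof (cases "z = 1")
    case True
    then show ?thesis using z1 by (simp add: z)
  next
    case False
    then show ?thesis using z1 zN geometric_sum[OF False, of N] by (simp add: z)
  qed
qed

text \<open>The exponents of the two roots of unity are \<open>a\<close> and
  \<open>a + 2 * b\<close>, which have equal parity. For \<open>a < 2 * r\<close> and
  \<open>b < r\<close> every element of the group of order \<open>2 * r\<^sup>2\<close> occurs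
  exactly once.\<close>

definition torus_rot :: "nat \<Rightarrow> nat \<Rightarrow> nat \<Rightarrow> (nat \<Rightarrow> real) \<Rightarrow> nat \<Rightarrow> real" where
  "torus_rot r a b x = rot 0 1 (cos (pi * real a / real r)) (sin (pi * real a / real r))
     (rot 2 3 (cos (pi * (real a + 2 * real b) / real r)) (sin (pi * (real a + 2 * real b) / real r)) x)"

lemma torus_rot_complex:
  "Complex (torus_rot r a b x 0) (torus_rot r a b x 1) = cis (pi * real a / real r) * Complex (x 0) (x 1)"
  "Complex (torus_rot r a b x 2) (torus_rot r a b x 3) = cis (pi * (real a + 2 * real b) / real r) * Complex (x 2) (x 3)"
  by (simp_all add: torus_rot_def rot_def complex_eq_iff)

lemma integral_sphere_torus_rot:
  assumes f: "f \<in> borel_measurable (lborel_PiM 3)"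
  shows "(\<integral>x. f (torus_rot r a b x) \<partial>sphere_measure 3) = (\<integral>x. (f x :: real) \<partial>sphere_measure 3)"
proof -
  let ?R = "rot 0 1 (cos (pi * real a / real r)) (sin (pi * real a / real r))"
  have "?R \<in> lborel_PiM 3 \<rightarrow>\<^sub>M lborel_PiM 3"
    using vol_preserving_rot[of 0 3 1 "cos (pi * real a / real r)" "sin (pi * real a / real r)"]
    by (simp add: vol_preserving_def)
  from measurable_compose[OF this f]
  have "(\<integral>x. f (torus_rot r a b x) \<partial>sphere_measure 3) = (\<integral>x. f (?R x) \<partial>sphere_measure 3)"
    unfolding torus_rot_def by (rule integral_sphere_rot[rotated -1]) auto
  also have "\<dots> = (\<integral>x. f x \<partial>sphere_measure 3)"
    by (rule integral_sphere_rot[OF _ _ _ _ f]) auto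
  finally show ?thesis .
qed

lemma torus_rot_in_sphere:
  assumes "x \<in> unit_sphere 3"
  shows "torus_rot r a b x \<in> unit_sphere 3"
proof -
  let ?y = "torus_rot r a b x"
  have 1: "(cmod (Complex (?y 0) (?y 1)))\<^sup>2 = (cmod (Complex (x 0) (x 1)))\<^sup>2"
    and 2: "(cmod (Complex (?y 2) (?y 3)))\<^sup>2 = (cmod (Complex (x 2) (x 3)))\<^sup>2"
    unfolding torus_rot_complex by (simp_all add: norm_mult)
  have "(\<Sum>i\<le>3. (?y i)\<^sup>2) = 1"
    using 1 2 unit_sphere_3[OF assms] by (simp add: cmod_power2 sum_atMost_3)
  moreover have "?y \<in> {..3} \<rightarrow>\<^sub>E UNIV"
    using assms by (auto simp: unit_sphere_def torus_rot_def rot_def PiE_def extensional_def)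
  ultimately show ?thesis
    by (simp add: unit_sphere_def eucl_norm_def)
qed

text \<open>This is the reason for using \<open>z\<close> and \<open>cnj z\<close>: under a rotation
  each term is multiplied by a character, with frequency \<open>m - 2 * j\<close>.\<close>

lemma cis_power_cnj:
  assumes "j \<le> m"
  shows "(cis u * z) ^ (m - j) * cnj (cis u * z) ^ j = cis (of_int (int m - 2 * int j) * u) * (z ^ (m - j) * cnj z ^ j)"
proof -
  have "(cis u * z) ^ (m - j) * cnj (cis u * z) ^ j = (cis u ^ (m - j) * cnj (cis u) ^ j) * (z ^ (m - j) * cnj z ^ j)"
    by (simp only: power_mult_distrib complex_cnj_mult mult_ac)
  also have "cis u ^ (m - j) * cnj (cis u) ^ j = cis (of_int (int m - 2 * int j) * u)"
    unfolding cis_cnj Complex.DeMoivre cis_mult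
    by (rule arg_cong[of _ _ cis]) (use assms in \<open>simp add: of_nat_diff algebra_simps\<close>)
  finally show ?thesis .
qed

lemma sum_cis_power_cnj:
  "(\<Sum>j\<le>m. c j * ((cis u * z) ^ (m - j) * cnj (cis u * z) ^ j)) =
    (\<Sum>j\<le>m. c j * (cis (of_int (int m - 2 * int j) * u) * (z ^ (m - j) * cnj z ^ j)))"
  by (intro sum.cong refl) (simp only: cis_power_cnj atMost_iff)

text \<open>Let \<open>k\<close> and \<open>k'\<close> be the two frequencies. The double sum
  factors into a character sum of order \<open>2 * r\<close> with frequency \<open>k + k'\<close>
  and one of order \<open>r\<close> with frequency \<open>k'\<close>. If both are nonzero, then
  \<open>k + k' = 0\<close>, as its absolute value is at most \<open>p + q < 2 * r\<close>. So
  \<open>k\<close> and \<open>k'\<close> have equal absolute value, which is below \<open>r\<close>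
  by the same bound, and divisibility by \<open>r\<close> forces \<open>k' = 0\<close>.\<close>

lemma torus_character_sum:
  assumes r: "0 < r" and jl: "j \<le> p" "l \<le> q" "p + q < 2 * r"
  shows "(\<Sum>a<2 * r. \<Sum>b<r. cis (of_int (int p - 2 * int j) * (pi * real a / real r)) * cis (of_int (int q - 2 * int l) * (pi * (real a + 2 * real b) / real r)))
    = (if 2 * j = p \<and> 2 * l = q then of_nat (2 * r\<^sup>2) else 0)"
proof -
  define k where "k = int p - 2 * int j"
  define k' where "k' = int q - 2 * int l"
  have bounds: "\<bar>k\<bar> \<le> int p" "\<bar>k'\<bar> \<le> int q"
    using jl by (auto simp: k_def k'_def)
  have *: "cis (of_int k * (pi * real a / real r)) * cis (of_int k' * (pi * (real a + 2 * real b) / real r))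
      = cis (2 * pi * of_int (k + k') * real a / real (2 * r)) * cis (2 * pi * of_int k' * real b / real r)" for a b :: nat
    unfolding cis_mult using r by (intro arg_cong[of _ _ cis]) (simp add: field_simps)
  have "(\<Sum>a<2 * r. \<Sum>b<r. cis (of_int k * (pi * real a / real r)) * cis (of_int k' * (pi * (real a + 2 * real b) / real r)))
      = (\<Sum>a<2 * r. cis (2 * pi * of_int (k + k') * real a / real (2 * r))) * (\<Sum>b<r. cis (2 * pi * of_int k' * real b / real r))"
    unfolding * sum_product ..
  also have "\<dots> = (if int (2 * r) dvd k + k' then of_nat (2 * r) else 0) * (if int r dvd k' then of_nat r else 0)"
    using r by (subst (1 2) sum_cis_roots_of_unity) auto
  also have "\<dots> = (if k = 0 \<and> k' = 0 then of_nat (2 * r\<^sup>2) else 0)"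
  proof -
    have "k = 0 \<and> k' = 0" if "int (2 * r) dvd k + k'" "int r dvd k'"
    proof -
      have "k + k' = 0"
      proof (rule ccontr)
        assume "k + k' \<noteq> 0"
        from dvd_imp_le_int[OF this that(1)] show False using bounds jl(3) by linarith
      qed
      then have "\<bar>k'\<bar> < int r" using bounds jl(3) by linarith
      have "k' = 0"
      proof (rule ccontr)
        assume "k' \<noteq> 0"
        from dvd_imp_le_int[OF this that(2)] show False using \<open>\<bar>k'\<bar> < int r\<close> by linarith
      qed
      with \<open>k + k' = 0\<close> show ?thesis by simp
    qed
    then show ?thesis by (auto simp: power2_eq_square)
  qed
  also have "(k = 0 \<and> k' = 0) = (2 * j = p \<and> 2 * l = q)"
    by (auto simp: k_def k'_def)
  finally show ?thesis by (simp add: k_def k'_def)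
qed

text \<open>Only the term of frequency zero in both variables survives the summation. It is a
  multiple of \<open>|z|^p * |w|^q\<close>, hence of
  \<open>lat x ^ (p div 2) * (1 - lat x) ^ (q div 2)\<close> on the sphere, with \<open>p\<close>
  and \<open>q\<close> even.\<close>

lemma torus_sum_monomial:
  assumes r: "0 < r" and \<alpha>: "\<alpha> 0 + \<alpha> 1 + \<alpha> 2 + \<alpha> 3 < 2 * r"
  shows "\<exists>f. degree f < r \<and> (\<forall>x\<in>unit_sphere 3.
    (\<Sum>a<2 * r. \<Sum>b<r. monomial 3 \<alpha> (torus_rot r a b x)) = poly f (lat x))"
proof -
  define p where "p = \<alpha> 0 + \<alpha> 1"
  define q where "q = \<alpha> 2 + \<alpha> 3"
  obtain c where c: "\<And>z. of_real (Re z ^ \<alpha> 0 * Im z ^ \<alpha> 1) = (\<Sum>j\<le>p. c j * (z ^ (p - j) * cnj z ^ j))"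
    using homogeneous_monomial[of "\<alpha> 0" "\<alpha> 1"] by (auto simp: homogeneous_def p_def)
  obtain d where d: "\<And>z. of_real (Re z ^ \<alpha> 2 * Im z ^ \<alpha> 3) = (\<Sum>l\<le>q. d l * (z ^ (q - l) * cnj z ^ l))"
    using homogeneous_monomial[of "\<alpha> 2" "\<alpha> 3"] by (auto simp: homogeneous_def q_def)
  \<comment> \<open>The surviving coefficient; for odd \<open>p\<close> or \<open>q\<close> there is
    none. The sum itself is real, so \<open>f\<close> may be built from \<open>Re K\<close>.\<close>
  define K where "K = (if even p \<and> even q then c (p div 2) * d (q div 2) * of_nat (2 * r\<^sup>2) else 0)"
  define f where "f = smult (Re K) ([:0, 1:] ^ (p div 2) * [:1, -1:] ^ (q div 2))"
  have "(\<Sum>a<2 * r. \<Sum>b<r. monomial 3 \<alpha> (torus_rot r a b x)) = poly f (lat x)" if x: "x \<in> unit_sphere 3" for x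
  proof -
    define z where "z = Complex (x 0) (x 1)"
    define w where "w = Complex (x 2) (x 3)"
    define Z where "Z j = z ^ (p - j) * cnj z ^ j" for j
    define W where "W l = w ^ (q - l) * cnj w ^ l" for l
    define u where "u j a = cis (of_int (int p - 2 * int j) * (pi * real a / real r))" for j and a :: nat
    define v where "v l a b = cis (of_int (int q - 2 * int l) * (pi * (real a + 2 * real b) / real r))" for l and a b :: nat
    have expand: "of_real (monomial 3 \<alpha> (torus_rot r a b x)) =
      (\<Sum>j\<le>p. \<Sum>l\<le>q. c j * d l * Z j * W l * (u j a * v l a b))" for a b
    proof -
      let ?y = "torus_rot r a b x"
      have "complex_of_real (monomial 3 \<alpha> ?y) =
          of_real (Re (Complex (?y 0) (?y 1)) ^ \<alpha> 0 * Im (Complex (?y 0) (?y 1)) ^ \<alpha> 1) *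
          of_real (Re (Complex (?y 2) (?y 3)) ^ \<alpha> 2 * Im (Complex (?y 2) (?y 3)) ^ \<alpha> 3)"
        by (simp add: prod_atMost_3 mult.assoc)
      also have "\<dots> = (\<Sum>j\<le>p. c j * (u j a * Z j)) * (\<Sum>l\<le>q. d l * (v l a b * W l))"
        unfolding c d torus_rot_complex Z_def W_def u_def v_def z_def[symmetric] w_def[symmetric]
        by (simp only: sum_cis_power_cnj)
      also have "\<dots> = (\<Sum>j\<le>p. \<Sum>l\<le>q. c j * d l * Z j * W l * (u j a * v l a b))"
        unfolding sum_product by (intro sum.cong refl) (simp only: mult_ac)
      finally show ?thesis .
    qed
    have "complex_of_real (\<Sum>a<2 * r. \<Sum>b<r. monomial 3 \<alpha> (torus_rot r a b x)) =
        (\<Sum>a<2 * r. \<Sum>b<r. \<Sum>j\<le>p. \<Sum>l\<le>q. c j * d l * Z j * W l * (u j a * v l a b))"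
      unfolding of_real_sum expand ..
    also have "\<dots> = (\<Sum>a<2 * r. \<Sum>j\<le>p. \<Sum>b<r. \<Sum>l\<le>q. c j * d l * Z j * W l * (u j a * v l a b))"
      by (intro sum.cong refl sum.swap)
    also have "\<dots> = (\<Sum>a<2 * r. \<Sum>j\<le>p. \<Sum>l\<le>q. \<Sum>b<r. c j * d l * Z j * W l * (u j a * v l a b))"
      by (intro sum.cong refl sum.swap)
    also have "\<dots> = (\<Sum>j\<le>p. \<Sum>a<2 * r. \<Sum>l\<le>q. \<Sum>b<r. c j * d l * Z j * W l * (u j a * v l a b))"
      by (rule sum.swap)
    also have "\<dots> = (\<Sum>j\<le>p. \<Sum>l\<le>q. \<Sum>a<2 * r. \<Sum>b<r. c j * d l * Z j * W l * (u j a * v l a b))"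
      by (intro sum.cong refl sum.swap)
    also have "\<dots> = (\<Sum>j\<le>p. \<Sum>l\<le>q. c j * d l * Z j * W l * (if 2 * j = p \<and> 2 * l = q then of_nat (2 * r\<^sup>2) else 0))"
    proof (intro sum.cong refl)
      fix j l assume "j \<in> {..p}" "l \<in> {..q}"
      then have "(\<Sum>a<2 * r. \<Sum>b<r. u j a * v l a b) = (if 2 * j = p \<and> 2 * l = q then of_nat (2 * r\<^sup>2) else 0)"
        using torus_character_sum[OF r, of j p l q] \<alpha> by (simp only: u_def v_def p_def q_def atMost_iff)
      then show "(\<Sum>a<2 * r. \<Sum>b<r. c j * d l * Z j * W l * (u j a * v l a b))
          = c j * d l * Z j * W l * (if 2 * j = p \<and> 2 * l = q then of_nat (2 * r\<^sup>2) else 0)"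
        unfolding sum_distrib_left[symmetric] by (rule arg_cong)
    qed
    also have "\<dots> = K * of_real (lat x ^ (p div 2) * (1 - lat x) ^ (q div 2))"
    proof (cases "even p \<and> even q")
      case False
      then have no: "(2 * j = p \<and> 2 * l = q) = False" for j l by auto
      have "K = 0" using False by (auto simp: K_def)
      then show ?thesis unfolding no by simp
    next
      case True
      then have pq: "p - p div 2 = p div 2" "q - q div 2 = q div 2" by auto
      have eq: "2 * j = p \<and> 2 * l = q \<longleftrightarrow> j = p div 2 \<and> l = q div 2" for j l
        using True by auto
      have "(\<Sum>j\<le>p. \<Sum>l\<le>q. c j * d l * Z j * W l * (if 2 * j = p \<and> 2 * l = q then of_nat (2 * r\<^sup>2) else 0))
          = (\<Sum>j\<le>p. if j = p div 2 then (\<Sum>l\<le>q. if l = q div 2 then c j * d l * Z j * W l * of_nat (2 * r\<^sup>2) else 0) else 0)"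
        unfolding eq
      proof (intro sum.cong refl)
        fix j
        show "(\<Sum>l\<le>q. c j * d l * Z j * W l * (if j = p div 2 \<and> l = q div 2 then of_nat (2 * r\<^sup>2) else 0))
          = (if j = p div 2 then (\<Sum>l\<le>q. if l = q div 2 then c j * d l * Z j * W l * of_nat (2 * r\<^sup>2) else 0) else 0)"
        proof (cases "j = p div 2")
          case True
          show ?thesis
            unfolding if_P[OF True] by (rule sum.cong) (use True in auto)
        qed simp
      qed
      also have "\<dots> = c (p div 2) * d (q div 2) * Z (p div 2) * W (q div 2) * of_nat (2 * r\<^sup>2)"
        by (simp only: sum.delta finite_atMost atMost_iff) simp
      also have "Z (p div 2) = of_real (lat x ^ (p div 2))"
        by (simp add: Z_def pq lat_def z_def complex_mult_cnj flip: power_mult_distrib)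
      also have "W (q div 2) = of_real ((1 - lat x) ^ (q div 2))"
      proof -
        have "1 - lat x = (x 2)\<^sup>2 + (x 3)\<^sup>2" using unit_sphere_3[OF x] by (simp add: lat_def)
        then show ?thesis
          by (simp add: W_def pq w_def complex_mult_cnj flip: power_mult_distrib)
      qed
      finally show ?thesis using True by (simp add: K_def mult_ac)
    qed
    finally have S: "complex_of_real (\<Sum>a<2 * r. \<Sum>b<r. monomial 3 \<alpha> (torus_rot r a b x))
        = K * of_real (lat x ^ (p div 2) * (1 - lat x) ^ (q div 2))" .
    have "(\<Sum>a<2 * r. \<Sum>b<r. monomial 3 \<alpha> (torus_rot r a b x))
        = Re (complex_of_real (\<Sum>a<2 * r. \<Sum>b<r. monomial 3 \<alpha> (torus_rot r a b x)))"
      by (rule Re_complex_of_real[symmetric])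
    also have "\<dots> = Re (K * of_real (lat x ^ (p div 2) * (1 - lat x) ^ (q div 2)))"
      unfolding S ..
    also have "\<dots> = poly f (lat x)"
      by (simp add: f_def poly_power mult.commute)
    finally show ?thesis .
  qed
  moreover have "degree f < r"
  proof -
    have "degree f \<le> degree ([:0, 1:] ^ (p div 2) * [:1, -1 :: real:] ^ (q div 2))"
      unfolding f_def by (rule degree_smult_le)
    also have "\<dots> \<le> degree ([:0, 1 :: real:] ^ (p div 2)) + degree ([:1, -1 :: real:] ^ (q div 2))"
      by (rule degree_mult_le)
    also have "\<dots> = p div 2 + q div 2"
      by (simp add: degree_power_eq)
    also have "\<dots> < r" using \<alpha> by (simp add: p_def q_def)
    finally show ?thesis .
  qed
  ultimately show ?thesis by blast
qed

lemma torus_rot_measurable: "torus_rot r a b \<in> lborel_PiM 3 \<rightarrow>\<^sub>M lborel_PiM 3"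
proof -
  have "rot i j (cos u) (sin u) \<in> lborel_PiM 3 \<rightarrow>\<^sub>M lborel_PiM 3" if "i \<le> 3" "j \<le> 3" "i \<noteq> j" for i j u
    using vol_preserving_rot[OF that, of "cos u" "sin u"] by (simp add: vol_preserving_def)
  from measurable_compose[OF this[of 2 3] this[of 0 1]] show ?thesis
    unfolding torus_rot_def[abs_def] by simp
qed

section \<open>Orbits of the points (sqrt t, sqrt (1 - t)) of C^2 and the resulting formulas\<close>

definition lat_point :: "real \<Rightarrow> nat \<Rightarrow> real" where
  "lat_point t = (\<lambda>i\<in>{..3}. if i = 0 then sqrt t else if i = 2 then sqrt (1 - t) else 0)"

lemma lat_point_in_sphere: "t \<in> {0..1} \<Longrightarrow> lat_point t \<in> unit_sphere 3"
  by (simp add: unit_sphere_def eucl_norm_def sum_atMost_3 lat_point_def)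

lemma lat_lat_point: "t \<in> {0..1} \<Longrightarrow> lat (lat_point t) = t"
  by (simp add: lat_def lat_point_def)

definition torus_orbit :: "nat \<Rightarrow> real \<Rightarrow> (nat \<Rightarrow> real) set" where
  "torus_orbit r t = (\<lambda>(a, b). torus_rot r a b (lat_point t)) ` ({..<2 * r} \<times> {..<r})"

lemma card_torus_orbit: "card (torus_orbit r t) \<le> 2 * r\<^sup>2"
  unfolding torus_orbit_def by (rule order_trans[OF card_image_le]) (auto simp: power2_eq_square)

text \<open>The second complex coordinate is 0, so a point of the orbit depends on \<open>a\<close>
  alone.\<close>

lemma card_torus_orbit_1: "card (torus_orbit r 1) \<le> 2 * r"
proof -
  have "torus_orbit r 1 \<subseteq> (\<lambda>a. torus_rot r a 0 (lat_point 1)) ` {..<2 * r}"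
    by (auto simp: torus_orbit_def image_iff torus_rot_def rot_def lat_point_def fun_eq_iff)
  from surj_card_le[OF _ this] show ?thesis by simp
qed

text \<open>The first complex coordinate is 0, so only \<open>a + 2 * b\<close> modulo
  \<open>2 * r\<close> matters. As \<open>a + 2 * b < 4 * r\<close>, one subtraction of the period
  suffices.\<close>

lemma card_torus_orbit_0: "card (torus_orbit r 0) \<le> 2 * r"
proof -
  define P where "P c = rot 2 3 (cos (pi * real c / real r)) (sin (pi * real c / real r)) (lat_point 0)" for c
  have "torus_orbit r 0 \<subseteq> P ` {..<2 * r}"
  proof
    fix x assume "x \<in> torus_orbit r 0"
    then obtain a b where ab: "a < 2 * r" "b < r" "x = torus_rot r a b (lat_point 0)"
      by (auto simp: torus_orbit_def)
    have x: "x = P (a + 2 * b)"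
      unfolding ab(3) by (auto simp: P_def torus_rot_def rot_def lat_point_def fun_eq_iff)
    show "x \<in> P ` {..<2 * r}"
    proof (cases "a + 2 * b < 2 * r")
      case True
      then show ?thesis using x by auto
    next
      case False
      then obtain c where c: "a + 2 * b = c + 2 * r"
        by (metis le_Suc_ex add.commute not_less)
      have "pi * real (c + 2 * r) / real r = pi * real c / real r + 2 * pi"
        using ab by (simp add: field_simps)
      then have "P (c + 2 * r) = P c"
        unfolding P_def by (simp only: cos_periodic sin_periodic)
      moreover have "c < 2 * r" using c ab by simp
      ultimately show ?thesis using x c by auto
    qed
  qed
  from surj_card_le[OF _ this] show ?thesis by simp
qed

text \<open>Averaging over the group does not change the integral and turns a monomial of degree at
  most \<open>2 * s + 1 < 2 * r\<close> into \<open>poly f (lat x)\<close> with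
  \<open>degree f \<le> s\<close>. The one-dimensional rule integrates \<open>f\<close>, and each
  value \<open>poly f t\<close> is the sum of the monomial over the group orbit of
  \<open>lat_point t\<close>.\<close>

lemma torus_cubature:
  assumes A: "finite A" "A \<subseteq> {0..1}"
    and exact: "\<And>f. degree f \<le> s \<Longrightarrow> lat_functional f = (\<Sum>t\<in>A. W t * poly f t)"
  shows "\<exists>w. is_cubature 3 (2 * s + 1) (\<Union>t\<in>A. torus_orbit (s + 1) t) w"
proof -
  define r where "r = s + 1"
  have r: "0 < r" by (simp add: r_def)
  define G where "G = {..<2 * r} \<times> {..<r}"
  define g where "g = (\<lambda>(t, a, b). torus_rot r a b (lat_point t))"
  \<comment> \<open>The weight of a node is shared equally among the \<open>2 * r\<^sup>2\<close>
    group elements. Those with the same image point are merged by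
    \<open>is_cubature_family\<close>.\<close>
  define h where "h = (\<lambda>(t, ab :: nat \<times> nat). W t / (2 * real r ^ 2))"
  have sumG: "(\<Sum>(a, b)\<in>G. F a b) = (\<Sum>a<2 * r. \<Sum>b<r. F a b)" for F :: "nat \<Rightarrow> nat \<Rightarrow> real"
    unfolding G_def by (simp add: sum.cartesian_product)
  have "is_cubature 3 (2 * s + 1) (g ` (A \<times> G)) (\<lambda>p. \<Sum>t\<in>{t\<in>A \<times> G. g t = p}. h t)"
  proof (rule is_cubature_family)
    show "finite (A \<times> G)" using A by (simp add: G_def)
    show "g ` (A \<times> G) \<subseteq> unit_sphere 3"
      using A by (auto simp: g_def intro!: torus_rot_in_sphere lat_point_in_sphere)
    fix \<alpha> assume "\<alpha> \<in> multi_indices 3 (2 * s + 1)"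
    then have "\<alpha> 0 + \<alpha> 1 + \<alpha> 2 + \<alpha> 3 < 2 * r"
      by (simp add: multi_indices_def sum_atMost_3 r_def)
    from torus_sum_monomial[OF r this] obtain f where f: "degree f < r"
      "\<And>x. x \<in> unit_sphere 3 \<Longrightarrow> (\<Sum>a<2 * r. \<Sum>b<r. monomial 3 \<alpha> (torus_rot r a b x)) = poly f (lat x)"
      by blast
    let ?E = "\<integral>x. monomial 3 \<alpha> x \<partial>sphere_measure 3"
    have int: "integrable (sphere_measure 3) (\<lambda>x. monomial 3 \<alpha> (torus_rot r a b x))" for a b
    proof (rule integrable_sphere_measure_bounded[where K = 1])
      show "(\<lambda>x. monomial 3 \<alpha> (torus_rot r a b x)) \<in> borel_measurable (lborel_PiM 3)"
        by (rule measurable_compose[OF torus_rot_measurable monomial_measurable])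
      fix x assume "x \<in> unit_sphere 3"
      then have "torus_rot r a b x \<in> unit_sphere 3" by (rule torus_rot_in_sphere)
      then show "\<bar>monomial 3 \<alpha> (torus_rot r a b x)\<bar> \<le> 1"
        unfolding abs_prod power_abs using unit_sphere_abs_le_1
        by (intro prod_le_1) (auto intro: power_le_one)
    qed
    have "(2 * real r ^ 2) * ?E = (\<Sum>a<2 * r. \<Sum>b<r. ?E)"
      by (simp add: power2_eq_square)
    also have "\<dots> = (\<Sum>a<2 * r. \<Sum>b<r. \<integral>x. monomial 3 \<alpha> (torus_rot r a b x) \<partial>sphere_measure 3)"
      by (simp only: integral_sphere_torus_rot[OF monomial_measurable])
    also have "\<dots> = (\<integral>x. (\<Sum>a<2 * r. \<Sum>b<r. monomial 3 \<alpha> (torus_rot r a b x)) \<partial>sphere_measure 3)"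
      using int by (simp only: Bochner_Integration.integral_sum Bochner_Integration.integrable_sum)
    also have "\<dots> = lat_functional f"
      unfolding lat_functional_def using f(2)
      by (intro Bochner_Integration.integral_cong refl) (simp only: space_sphere_measure)
    also have "\<dots> = (\<Sum>t\<in>A. W t * poly f t)"
      using f(1) by (intro exact) (simp add: r_def)
    also have "\<dots> = (\<Sum>t\<in>A. W t * (\<Sum>(a, b)\<in>G. monomial 3 \<alpha> (torus_rot r a b (lat_point t))))"
    proof (intro sum.cong refl)
      fix t assume "t \<in> A"
      then have t: "t \<in> {0..1}" using A by blast
      show "W t * poly f t = W t * (\<Sum>(a, b)\<in>G. monomial 3 \<alpha> (torus_rot r a b (lat_point t)))"
        unfolding sumG f(2)[OF lat_point_in_sphere[OF t]] lat_lat_point[OF t] ..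
    qed
    finally have "?E = (\<Sum>t\<in>A. W t * (\<Sum>(a, b)\<in>G. monomial 3 \<alpha> (torus_rot r a b (lat_point t)))) / (2 * real r ^ 2)"
      using r by (simp add: field_simps)
    also have "\<dots> = (\<Sum>t\<in>A. \<Sum>ab\<in>G. h (t, ab) * monomial 3 \<alpha> (g (t, ab)))"
      unfolding h_def g_def sum_divide_distrib sum_distrib_left
      by (intro sum.cong refl) (simp add: case_prod_unfold)
    also have "\<dots> = (\<Sum>t\<in>A \<times> G. h t * monomial 3 \<alpha> (g t))"
      by (simp add: sum.cartesian_product)
    finally show "?E = (\<Sum>t\<in>A \<times> G. h t * monomial 3 \<alpha> (g t))" .
  qed
  moreover have "g ` (A \<times> G) = (\<Union>t\<in>A. torus_orbit (s + 1) t)"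
    unfolding torus_orbit_def g_def G_def r_def by (auto simp: image_iff split: prod.splits) blast+
  ultimately show ?thesis by metis
qed

lemma card_UN_torus_orbit:
  assumes "finite A"
  shows "card (\<Union>t\<in>A. torus_orbit r t) \<le> card A * (2 * r\<^sup>2)"
proof -
  have "card (\<Union>t\<in>A. torus_orbit r t) \<le> (\<Sum>t\<in>A. card (torus_orbit r t))"
    using assms by (rule card_UN_le)
  also have "\<dots> \<le> (\<Sum>t\<in>A. 2 * r\<^sup>2)"
    by (intro sum_mono card_torus_orbit)
  finally show ?thesis by simp
qed

text \<open>For \<open>s = 2 * m + 1\<close> there are two small orbits and \<open>m\<close> large
  ones, at most \<open>4 * (s + 1) + (s - 1) * (s + 1)\<^sup>2\<close> points. For
  \<open>s = 2 * m\<close> there is one small orbit, giving at most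
  \<open>2 * (s + 1) + s * (s + 1)\<^sup>2\<close>. These are the required counts, and padding makes
  up for any coincidences.\<close>

lemma cubature_S3:
  "\<exists>F w. is_cubature 3 (2 * s + 1) F w \<and>
    card F = (if odd s then (s + 1) * (s ^ 2 + 3) else (s + 1) * (s ^ 2 + s + 2))"
proof (cases "odd s")
  case True
  then obtain m where m: "s = 2 * m + 1" by (auto elim: oddE)
  obtain A W where A: "finite A" "A \<subseteq> {0<..<1}" "card A = m"
    "\<And>f. degree f \<le> s \<Longrightarrow> lat_functional f = (\<Sum>a\<in>insert 0 (insert 1 A). W a * poly f a)"
    using lat.gauss_lobatto_quadrature[of m] m by auto
  let ?F = "\<Union>t\<in>insert 0 (insert 1 A). torus_orbit (s + 1) t"
  obtain w where w: "is_cubature 3 (2 * s + 1) ?F w"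
    using torus_cubature[OF _ _ A(4)] A(1,2) by fastforce
  have "card ?F \<le> (s + 1) * (s ^ 2 + 3)"
  proof -
    have "card ?F \<le> card (torus_orbit (s + 1) 0) + (card (torus_orbit (s + 1) 1) + card (\<Union>t\<in>A. torus_orbit (s + 1) t))"
      unfolding UN_insert by (rule order_trans[OF card_Un_le add_left_mono[OF card_Un_le]])
    also have "\<dots> \<le> 2 * (s + 1) + (2 * (s + 1) + m * (2 * (s + 1)\<^sup>2))"
      using card_torus_orbit_0[of "s + 1"] card_torus_orbit_1[of "s + 1"] card_UN_torus_orbit[OF A(1), of "s + 1"] A(3)
      by (intro add_mono) simp_all
    also have "\<dots> = (s + 1) * (s ^ 2 + 3)"
      unfolding m by (simp add: power2_eq_square algebra_simps)
    finally show ?thesis .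
  qed
  from is_cubature_pad[OF w _ this] show ?thesis
    using True by simp
next
  case False
  then obtain m where m: "s = 2 * m" by (auto elim: evenE)
  obtain A W where A: "finite A" "A \<subseteq> {0<..<1}" "card A = m"
    "\<And>f. degree f \<le> s \<Longrightarrow> lat_functional f = (\<Sum>a\<in>insert 0 A. W a * poly f a)"
    using lat.gauss_radau_quadrature[of m] m by auto
  let ?F = "\<Union>t\<in>insert 0 A. torus_orbit (s + 1) t"
  obtain w where w: "is_cubature 3 (2 * s + 1) ?F w"
    using torus_cubature[OF _ _ A(4)] A(1,2) by fastforce
  have "card ?F \<le> (s + 1) * (s ^ 2 + s + 2)"
  proof -
    have "card ?F \<le> card (torus_orbit (s + 1) 0) + card (\<Union>t\<in>A. torus_orbit (s + 1) t)"
      unfolding UN_insert by (rule card_Un_le)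
    also have "\<dots> \<le> 2 * (s + 1) + m * (2 * (s + 1)\<^sup>2)"
      using card_torus_orbit_0[of "s + 1"] card_UN_torus_orbit[OF A(1), of "s + 1"] A(3)
      by (intro add_mono) simp_all
    also have "\<dots> = (s + 1) * (s ^ 2 + s + 2)"
      unfolding m by (simp add: power2_eq_square algebra_simps)
    finally show ?thesis .
  qed
  from is_cubature_pad[OF w _ this] show ?thesis
    using False by simp
qed

theorem corollary4p2:
  shows "(\<exists>N :: nat \<Rightarrow> nat.
      (\<forall>n. \<exists>F w. is_cubature n 7 F w \<and> card F = N n) \<and>
      (\<exists>C :: real. \<forall>n\<ge>1. real (N n) \<le> C * real n ^ 4) \<and>
      (\<lambda>n. real (N n)) \<sim>[at_top] (\<lambda>n. 4 * real n ^ 4)) \<and>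
    (\<forall>s :: nat. \<exists>F w. is_cubature 3 (2 * s + 1) F w \<and>
      card F = (if odd s then (s + 1) * (s ^ 2 + 3) else (s + 1) * (s ^ 2 + s + 2)))"
  using cubature_7_asymptotic cubature_S3 by blast

end
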